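(* Let $\Lambda=[\mu_1,L_1]\cup[\mu_2,L_2]$ with $0<\mu_1<L_1<\mu_2<L_2$ and $L_1-\mu_1=L_2-\mu_2$; let $\rho=\frac{L_2+\mu_1}{L_2-\mu_1}$, $R=\frac{\mu_2-L_1}{L_2-\mu_1}$, $c=\sqrt{\frac{\rho^2-R^2}{1-R^2}}$ and $\sigma_2^\Lambda(\lambda)=2c^2(1-\lambda/L_1)(1-\lambda/\mu_2)-1$. For $f\in\mathcal{C}_\Lambda$ and $x_0\in\mathbb{R}^d$ define $\omega_0=2$, $x_1=x_0-\frac1{L_1}\nabla f(x_0)$ and for $t\ge1$: $\omega_t=\big(1-\frac{\omega_{t-1}}{4c^2}\big)^{-1}$, $h_t=\omega_t/L_1$ if $t$ is even and $h_t=\omega_t/\mu_2$ if $t$ is odd, $x_{t+1}=x_t-h_t\nabla f(x_t)+(\omega_t-1)(x_t-x_{t-1})$. Then for all $n\ge0$, $$x_{2n}-x_*=\frac{T_n(\sigma_2^\Lambda(H))}{T_n(\sigma_2^\Lambda(0))}(x_0-x_* ),$$ and for each $n\ge1$ the polynomial $T_n(\sigma_2^\Lambda(\cdot))/T_n(\sigma_2^\Lambda(0))$ minimizes $\sup_{\lambda\in\Lambda}|P(\lambda)|$ among all real polynomials $P$ of degree at most $2n$ with $P(0)=1$; consequently no method whose iterates satisfy $x_{t+1}\in x_0+\operatorname{span}\{\nabla f(x_0),\dots,\nabla f(x_t)\}$ has a smaller worst-case rate over $\mathcal{C}_\Lambda$ at iteration $2n$.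
   Context: $\mathcal{C}_\Lambda$ is the class of all quadratic functions $f(x)=\tfrac12(x-x_* )^\top H(x-x_* )+f_*$ on $\mathbb{R}^d$ (any $d\ge1$) with $H$ symmetric and $\mathrm{Sp}(H)\subseteq\Lambda$. $T_n$ is the Chebyshev polynomial of the first kind of degree $n$. The worst-case rate of a method over $\mathcal{C}_\Lambda$ at iteration $t$ is $\sup_{f\in\mathcal{C}_\Lambda,x_0\ne x_*}\|x_t-x_*\|/\|x_0-x_*\|$. *)

theory Defs
  imports "Jordan_Normal_Form.Char_Poly" "HOL-Computational_Algebra.Polynomial"
    "HOL-Library.Extended_Real"
begin

fun cheb :: "nat \<Rightarrow> real poly" where
  "cheb 0 = 1"
| "cheb (Suc 0) = [:0, 1:]"
| "cheb (Suc (Suc n)) = Polynomial.smult 2 ([:0, 1:] * cheb (Suc n)) - cheb n"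

definition mat_poly :: "real poly \<Rightarrow> real mat \<Rightarrow> real mat" where
  "mat_poly p A = foldr (\<lambda>a B. a \<cdot>\<^sub>m 1\<^sub>m (dim_row A) + A * B) (coeffs p)
                     (0\<^sub>m (dim_row A) (dim_row A))"

definition vnorm :: "real vec \<Rightarrow> real" where
  "vnorm v = sqrt (scalar_prod v v)"

definition Lam :: "real \<Rightarrow> real \<Rightarrow> real \<Rightarrow> real \<Rightarrow> real set" where
  "Lam mu1 L1 mu2 L2 = {mu1..L1} \<union> {mu2..L2}"

(* f(x) = 1/2 (x-xs)^T H (x-xs) + fs  belongs to C_Lambda (in dimension d) *)
definition in_class :: "real set \<Rightarrow> nat \<Rightarrow> real mat \<Rightarrow> real vec \<Rightarrow> bool" where
  "in_class Lambda d H xs \<longleftrightarrow> H \<in> carrier_mat d d \<and> transpose_mat H = H \<and>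
     xs \<in> carrier_vec d \<and> {k. eigenvalue H k} \<subseteq> Lambda"

(* gradient of f(x) = 1/2 (x-xs)^T H (x-xs) + fs, H symmetric *)
definition grad :: "real mat \<Rightarrow> real vec \<Rightarrow> real vec \<Rightarrow> real vec" where
  "grad H xs x = H *\<^sub>v (x - xs)"

definition rho_p :: "real \<Rightarrow> real \<Rightarrow> real \<Rightarrow> real \<Rightarrow> real" where
  "rho_p mu1 L1 mu2 L2 = (L2 + mu1) / (L2 - mu1)"

definition R_p :: "real \<Rightarrow> real \<Rightarrow> real \<Rightarrow> real \<Rightarrow> real" where
  "R_p mu1 L1 mu2 L2 = (mu2 - L1) / (L2 - mu1)"

definition c_p :: "real \<Rightarrow> real \<Rightarrow> real \<Rightarrow> real \<Rightarrow> real" where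
  "c_p mu1 L1 mu2 L2 = sqrt (((rho_p mu1 L1 mu2 L2)\<^sup>2 - (R_p mu1 L1 mu2 L2)\<^sup>2)
                            / (1 - (R_p mu1 L1 mu2 L2)\<^sup>2))"

definition sigma2 :: "real \<Rightarrow> real \<Rightarrow> real \<Rightarrow> real \<Rightarrow> real poly" where
  "sigma2 mu1 L1 mu2 L2 =
     Polynomial.smult (2 * (c_p mu1 L1 mu2 L2)\<^sup>2) ([:1, - 1 / L1:] * [:1, - 1 / mu2:]) - 1"

definition Pn :: "real \<Rightarrow> real \<Rightarrow> real \<Rightarrow> real \<Rightarrow> nat \<Rightarrow> real poly" where
  "Pn mu1 L1 mu2 L2 n =
     Polynomial.smult (1 / poly (pcompose (cheb n) (sigma2 mu1 L1 mu2 L2)) 0)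
           (pcompose (cheb n) (sigma2 mu1 L1 mu2 L2))"

fun omega :: "real \<Rightarrow> nat \<Rightarrow> real" where
  "omega c 0 = 2"
| "omega c (Suc t) = inverse (1 - omega c t / (4 * c\<^sup>2))"

definition step :: "real \<Rightarrow> real \<Rightarrow> real \<Rightarrow> real \<Rightarrow> nat \<Rightarrow> real" where
  "step mu1 L1 mu2 L2 t =
     (if even t then omega (c_p mu1 L1 mu2 L2) t / L1 else omega (c_p mu1 L1 mu2 L2) t / mu2)"

fun cheb_method :: "real \<Rightarrow> real \<Rightarrow> real \<Rightarrow> real \<Rightarrow> real mat \<Rightarrow> real vec \<Rightarrow> real vec
    \<Rightarrow> nat \<Rightarrow> real vec" where
  "cheb_method mu1 L1 mu2 L2 H xs x0 0 = x0"
| "cheb_method mu1 L1 mu2 L2 H xs x0 (Suc 0) = x0 - (1 / L1) \<cdot>\<^sub>v grad H xs x0"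
| "cheb_method mu1 L1 mu2 L2 H xs x0 (Suc (Suc t)) =
     cheb_method mu1 L1 mu2 L2 H xs x0 (Suc t)
     - step mu1 L1 mu2 L2 (Suc t) \<cdot>\<^sub>v grad H xs (cheb_method mu1 L1 mu2 L2 H xs x0 (Suc t))
     + (omega (c_p mu1 L1 mu2 L2) (Suc t) - 1) \<cdot>\<^sub>v
         (cheb_method mu1 L1 mu2 L2 H xs x0 (Suc t) - cheb_method mu1 L1 mu2 L2 H xs x0 t)"

(* A (general, possibly f-dependent) method: M H xs fs x0 t is the t-th iterate on
   f(x) = 1/2 (x-xs)^T H (x-xs) + fs started at x0.  Krylov (span) condition: *)
definition krylov_method :: "real set \<Rightarrow>
    (real mat \<Rightarrow> real vec \<Rightarrow> real \<Rightarrow> real vec \<Rightarrow> nat \<Rightarrow> real vec) \<Rightarrow> bool" where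
  "krylov_method Lambda M \<longleftrightarrow>
     (\<forall>d H xs fs x0. 1 \<le> d \<and> in_class Lambda d H xs \<and> x0 \<in> carrier_vec d \<longrightarrow>
        M H xs fs x0 0 = x0 \<and>
        (\<forall>t. \<exists>a :: nat \<Rightarrow> real.
           M H xs fs x0 (Suc t) =
             x0 + finsum_vec TYPE(real) d (\<lambda>s. a s \<cdot>\<^sub>v grad H xs (M H xs fs x0 s)) {..t}))"

definition wc_rate :: "real set \<Rightarrow>
    (real mat \<Rightarrow> real vec \<Rightarrow> real \<Rightarrow> real vec \<Rightarrow> nat \<Rightarrow> real vec) \<Rightarrow> nat \<Rightarrow> ereal" where
  "wc_rate Lambda M t =
     (SUP (d, H, xs, fs, x0) \<in> {(d, H, xs, fs, x0). 1 \<le> d \<and> in_class Lambda d H xs \<and>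
                                   x0 \<in> carrier_vec d \<and> x0 \<noteq> xs}.
        ereal (vnorm (M H xs fs x0 t - xs) / vnorm (x0 - xs)))"

end

(*
  The normalized residual polynomials satisfy a two-periodic Chebyshev recurrence, whose even part
  is the Chebyshev recurrence in sigma2.  On Lambda the polynomial T_n(sigma2) is bounded by 1 and
  attains alternating values +1, -1 at 2n+1 increasing nodes.  Lagrange interpolation at these nodes,
  evaluated at 0, has weights of alternating sign, which gives nonnegative w on the nodes with
  sum w = T_n(sigma2(0)) and  1 <= sum w |P|  for all P of degree at most 2n with P(0) = 1.
  This certificate proves minimality, and also the lower bound for arbitrary span methods, even when
  the polynomial depends on f and x_0: take H diagonal with the nodes as spectrum and x_0 - x_* with
  squared coordinates w.
*)
theory Submission
  imports Defs "HOL-Computational_Algebra.Fundamental_Theorem_Algebra"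
begin

section \<open>Polynomials of a matrix applied to a vector\<close>

text \<open>Equal lengths mean \<open>mu1 + L2 = L1 + mu2\<close>, so the two intervals are mirror
  images about the vertex of the parabola \<open>sigma2\<close>, and each is mapped monotonically
  onto [-1,1]. The constant \<open>c_p\<close> is the scaling for which \<open>sigma2\<close> is -1
  at \<open>L1\<close> and \<open>mu2\<close>, and 1 at \<open>mu1\<close> and \<open>L2\<close>.
  The n+1 extremal points of T_n have 2n+2 preimages; \<open>L1\<close> and \<open>mu2\<close> lie
  over the same point -1 and carry the same sign, so \<open>mu2\<close> is left out, and 2n+1
  alternations remain, as degree 2n requires. The obstacle in the lower bound is the order of
  quantifiers: a method may adapt its coefficients to f and x_0, so it is not enough that each P is
  large somewhere on Lambda; one instance must defeat every P. The weights w are independent of P,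
  and Cauchy-Schwarz turns the bound on sum w |P| into a norm ratio of at least 1/T with T =
  T_n(sigma2(0)). For the matching upper bound, |P| <= 1/T on Lambda has to be transferred to
  P(H).\<close>

lemma mat_poly_carrier [simp]:
  assumes "A \<in> carrier_mat d d"
  shows "mat_poly p A \<in> carrier_mat d d"
proof -
  have "foldr (\<lambda>a B. a \<cdot>\<^sub>m 1\<^sub>m d + A * B) cs (0\<^sub>m d d) \<in> carrier_mat d d" for cs
    using assms by (induction cs) auto
  then show ?thesis
    using assms by (simp add: mat_poly_def)
qed

lemma mat_poly_0: "A \<in> carrier_mat d d \<Longrightarrow> mat_poly 0 A = 0\<^sub>m d d"
  by (simp add: mat_poly_def)

lemma mat_poly_pCons:
  assumes "A \<in> carrier_mat d d"
  shows "mat_poly (pCons a p) A = a \<cdot>\<^sub>m 1\<^sub>m d + A * mat_poly p A"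
\<comment> \<open>Only here does \<open>coeffs\<close> fail to gain the entry \<open>a\<close>: the
  zero polynomial has the empty list.\<close>
proof (cases "p = 0 \<and> a = 0")
  case True
  have "a \<cdot>\<^sub>m 1\<^sub>m d = 0\<^sub>m d d"
    using True by (intro eq_matI) auto
  then show ?thesis
    using True assms by (simp add: mat_poly_0)
next
  case False
  then have "coeffs (pCons a p) = a # coeffs p"
    by (auto simp: cCons_def)
  then show ?thesis
    using assms by (simp add: mat_poly_def)
qed

text \<open>This is the action that makes the vectors a module over the real polynomials. Stating
  the laws on vectors avoids an algebra of matrix polynomials.\<close>

abbreviation (input) poly_app :: "real mat \<Rightarrow> real poly \<Rightarrow> real vec \<Rightarrow> real vec" where
  "poly_app A p v \<equiv> mat_poly p A *\<^sub>v v"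

context
  fixes A :: "real mat" and d :: nat
  assumes A: "A \<in> carrier_mat d d"
begin

lemma poly_app_carrier [simp]:
  "v \<in> carrier_vec d \<Longrightarrow> poly_app A p v \<in> carrier_vec d"
  by (metis A mat_poly_carrier mult_mat_vec_carrier)

lemma poly_app_0: "v \<in> carrier_vec d \<Longrightarrow> poly_app A 0 v = 0\<^sub>v d"
  using A by (auto simp: mat_poly_0)

lemma poly_app_pCons:
  assumes v: "v \<in> carrier_vec d"
  shows "poly_app A (pCons a p) v = a \<cdot>\<^sub>v v + A *\<^sub>v poly_app A p v"
proof -
  have "mat_poly p A \<in> carrier_mat d d"
    using A by simp
  then have "poly_app A (pCons a p) v = (a \<cdot>\<^sub>m 1\<^sub>m d) *\<^sub>v v + (A * mat_poly p A) *\<^sub>v v"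
    using A v by (simp add: mat_poly_pCons add_mult_distrib_mat_vec[where nr = d and nc = d])
  also have "(a \<cdot>\<^sub>m 1\<^sub>m d) *\<^sub>v v = a \<cdot>\<^sub>v v"
    using v by (intro eq_vecI) (auto simp: row_smult row_one)
  also have "(A * mat_poly p A) *\<^sub>v v = A *\<^sub>v poly_app A p v"
    using A v by (intro assoc_mult_mat_vec) auto
  finally show ?thesis .
qed

lemma poly_app_1: "v \<in> carrier_vec d \<Longrightarrow> poly_app A 1 v = v"
  using A unfolding one_pCons by (simp add: poly_app_pCons poly_app_0 right_zero_vec) auto

lemma poly_app_X: "v \<in> carrier_vec d \<Longrightarrow> poly_app A [:0, 1:] v = A *\<^sub>v v"
proof -
  assume v: "v \<in> carrier_vec d"
  have "A *\<^sub>v 0\<^sub>v d = 0\<^sub>v d"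
    using A by (intro eq_vecI) auto
  then show ?thesis
    using A v by (intro eq_vecI) (auto simp: poly_app_pCons poly_app_0)
qed

lemma poly_app_add:
  assumes v: "v \<in> carrier_vec d"
  shows "poly_app A (p + q) v = poly_app A p v + poly_app A q v"
proof (induction p q rule: poly_induct2)
  case 0
  then show ?case using v by (simp add: poly_app_0)
next
  case (pCons a p b q)
  then show ?case
    using v A by (intro eq_vecI)
      (simp_all add: poly_app_pCons mult_add_distrib_mat_vec[where nr = d and nc = d] algebra_simps)
qed

lemma poly_app_smult:
  assumes v: "v \<in> carrier_vec d"
  shows "poly_app A (Polynomial.smult c p) v = c \<cdot>\<^sub>v poly_app A p v"
proof (induction p)
  case 0
  have "c \<cdot>\<^sub>v 0\<^sub>v d = 0\<^sub>v d"
    by (intro eq_vecI) auto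
  then show ?case using v by (simp add: poly_app_0)
next
  case (pCons a p)
  then show ?case
    using v A by (intro eq_vecI)
      (simp_all add: poly_app_pCons mult_mat_vec[where nr = d and nc = d] algebra_simps)
qed

lemma poly_app_diff:
  assumes v: "v \<in> carrier_vec d"
  shows "poly_app A (p - q) v = poly_app A p v - poly_app A q v"
proof -
  have "poly_app A (p - q) v = poly_app A (p + Polynomial.smult (- 1) q) v"
    by simp
  also have "\<dots> = poly_app A p v + (- 1) \<cdot>\<^sub>v poly_app A q v"
    by (simp only: poly_app_add[OF v] poly_app_smult[OF v])
  also have "\<dots> = poly_app A p v - poly_app A q v"
    using v A by (intro eq_vecI) auto
  finally show ?thesis .
qed

lemma poly_app_mult:
  assumes v: "v \<in> carrier_vec d"
  shows "poly_app A (p * q) v = poly_app A p (poly_app A q v)"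
proof (induction p)
  case 0
  then show ?case using v by (simp add: poly_app_0)
next
  case (pCons a p)
  then show ?case
    using v A by (intro eq_vecI) (simp_all add: poly_app_pCons poly_app_add poly_app_smult)
qed

text \<open>Inherited from the commutativity of polynomial multiplication.\<close>

lemma poly_app_commute:
  "v \<in> carrier_vec d \<Longrightarrow> A *\<^sub>v poly_app A p v = poly_app A p (A *\<^sub>v v)"
  using poly_app_mult[of v "[:0, 1:]" p] poly_app_mult[of v p "[:0, 1:]"]
  by (simp add: poly_app_X mult.commute)

lemma poly_app_zero_vec: "poly_app A p (0\<^sub>v d) = 0\<^sub>v d"
proof -
  have "poly_app A p (poly_app A 0 (0\<^sub>v d)) = poly_app A (p * 0) (0\<^sub>v d)"
    by (rule poly_app_mult[symmetric]) simp
  then show ?thesis by (simp add: poly_app_0)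
qed

text \<open>The annihilators of a vector form an ideal.\<close>

lemma poly_app_dvd_zero:
  assumes "v \<in> carrier_vec d" and "poly_app A q v = 0\<^sub>v d" and "q dvd p"
  shows "poly_app A p v = 0\<^sub>v d"
  using assms by (metis dvd_def mult.commute poly_app_mult poly_app_zero_vec)

context
  assumes sym: "transpose_mat A = A"
begin

lemma symmetric_scalar_prod:
  assumes "v \<in> carrier_vec d" "w \<in> carrier_vec d"
  shows "(A *\<^sub>v v) \<bullet> w = v \<bullet> (A *\<^sub>v w)"
  using transpose_vec_mult_scalar[OF A assms(2,1)] sym assms A
  by (metis comm_scalar_prod mult_mat_vec_carrier)

lemma poly_app_scalar_prod:
  assumes "v \<in> carrier_vec d" "w \<in> carrier_vec d"
  shows "poly_app A p v \<bullet> w = v \<bullet> poly_app A p w"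
  using assms
\<comment> \<open>\<open>w\<close> must vary: the induction hypothesis is applied to
  \<open>A *\<^sub>v w\<close>.\<close>
proof (induction p arbitrary: w)
  case 0
  then show ?case by (simp add: poly_app_0)
next
  case (pCons a p)
  have "poly_app A (pCons a p) v \<bullet> w = a * (v \<bullet> w) + (A *\<^sub>v poly_app A p v) \<bullet> w"
    using pCons.prems A
    by (simp add: poly_app_pCons add_scalar_prod_distrib[where n = d])
  also have "(A *\<^sub>v poly_app A p v) \<bullet> w = v \<bullet> poly_app A p (A *\<^sub>v w)"
    using pCons A by (simp add: symmetric_scalar_prod)
  also have "a * (v \<bullet> w) + \<dots> = v \<bullet> poly_app A (pCons a p) w"
    using pCons.prems A
    by (simp add: poly_app_pCons scalar_prod_add_distrib[where n = d] poly_app_commute)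
  finally show ?case .
qed

end

end

section \<open>Chebyshev and interpolation polynomials\<close>

lemma cheb_cos: "poly (cheb n) (cos t) = cos (real n * t)"
proof (induction n rule: cheb.induct)
  case (3 n)
  have "cos (real (Suc (Suc n)) * t) + cos (real n * t) = 2 * cos t * cos (real (Suc n) * t)"
    using cos_add[of "real (Suc n) * t" t] cos_diff[of "real (Suc n) * t" t]
    by (simp add: algebra_simps)
  with 3 show ?case
    by (simp add: algebra_simps)
qed auto

lemma abs_cheb_le_1:
  assumes "- 1 \<le> x" and "x \<le> 1"
  shows "\<bar>poly (cheb n) x\<bar> \<le> 1"
  using cheb_cos[of n "arccos x"] assms by (simp add: cos_arccos)

lemma cheb_ge_1:
  assumes "1 \<le> x"
  shows "1 \<le> poly (cheb n) x"
proof -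
  \<comment> \<open>The recurrence subtracts T_n, so the induction also needs monotonicity in the
    degree.\<close>
  have "1 \<le> poly (cheb n) x \<and> poly (cheb n) x \<le> poly (cheb (Suc n)) x"
  proof (induction n)
    case 0
    then show ?case using assms by simp
  next
    case (Suc n)
    have "1 * poly (cheb (Suc n)) x \<le> x * poly (cheb (Suc n)) x"
      using assms Suc by (intro mult_right_mono) auto
    with Suc have "poly (cheb (Suc n)) x \<le> 2 * (x * poly (cheb (Suc n)) x) - poly (cheb n) x"
      by linarith
    with Suc show ?case by (simp add: algebra_simps)
  qed
  then show ?thesis ..
qed

lemma degree_cheb_le: "degree (cheb n) \<le> n"
proof (induction n rule: cheb.induct)
  case (3 n)
  have "degree ([:0, 1:] * cheb (Suc n)) \<le> Suc (Suc n)"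
    using 3 degree_mult_le[of "[:0, 1:]" "cheb (Suc n)"] by simp
  then have "degree (Polynomial.smult 2 ([:0, 1:] * cheb (Suc n))) \<le> Suc (Suc n)"
    by (meson degree_smult_le order_trans)
  with 3 show ?case
    by (auto intro!: degree_diff_le)
qed auto

text \<open>The residual polynomial of the \<open>t\<close>-th iterate, multiplied by \<open>T\<^sub>t(c)\<close>.\<close>
fun scaled_residual :: "real \<Rightarrow> real \<Rightarrow> real \<Rightarrow> nat \<Rightarrow> real poly" where
  "scaled_residual c L1 mu2 0 = 1"
| "scaled_residual c L1 mu2 (Suc 0) = Polynomial.smult c [:1, - 1 / L1:]"
| "scaled_residual c L1 mu2 (Suc (Suc t)) =
     Polynomial.smult (2 * c) ([:1, - 1 / (if even t then mu2 else L1):]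
       * scaled_residual c L1 mu2 (Suc t)) - scaled_residual c L1 mu2 t"

lemma poly_scaled_residual_even:
  "poly (scaled_residual c L1 mu2 (2 * n)) x =
     poly (cheb n) (2 * c\<^sup>2 * (1 - x / L1) * (1 - x / mu2) - 1)"
proof (induction n rule: cheb.induct)
  case 1
  then show ?case by simp
next
  case 2
  then show ?case
    by (simp add: numeral_2_eq_2 power2_eq_square algebra_simps diff_divide_distrib)
next
  case (3 n)
  let ?S = "\<lambda>t. poly (scaled_residual c L1 mu2 t) x"
  define a b where "a = c * (1 - x / L1)" and "b = c * (1 - x / mu2)"
  have odd: "?S (Suc (2 * Suc n)) = 2 * a * ?S (2 * Suc n) - ?S (Suc (2 * n))"
    by (simp add: a_def algebra_simps diff_divide_distrib)
  have even: "?S (2 * Suc m) = 2 * b * ?S (Suc (2 * m)) - ?S (2 * m)" for m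
    by (simp add: b_def algebra_simps diff_divide_distrib)
  \<comment> \<open>Eliminates the odd indices: \<open>v\<close> and \<open>y\<close> are
    consecutive even terms, and 2bw = v + y removes the odd term \<open>w\<close>. What remains is
    the Chebyshev recurrence at 2ab - 1.\<close>
  have rearrange: "2 * b * u - v = 2 * (2 * a * b - 1) * v - y"
    if u: "u = 2 * a * v - w" and v: "v = 2 * b * w - y" for u v w y :: real
  proof -
    have "2 * b * u - v = 4 * a * b * v - 2 * b * w - v"
      unfolding u by (simp add: algebra_simps)
    also have "2 * b * w = v + y"
      using v by simp
    finally show ?thesis by (simp add: algebra_simps)
  qed
  have "?S (2 * Suc (Suc n)) = 2 * (2 * a * b - 1) * ?S (2 * Suc n) - ?S (2 * n)"
    unfolding even[of "Suc n"] by (rule rearrange[OF odd even])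
  also have "2 * a * b - 1 = 2 * c\<^sup>2 * (1 - x / L1) * (1 - x / mu2) - 1"
    by (simp add: a_def b_def power2_eq_square)
  finally show ?case
    using 3 by (simp del: scaled_residual.simps)
qed

lemma scaled_residual_even:
  "scaled_residual c L1 mu2 (2 * n) =
     pcompose (cheb n) (Polynomial.smult (2 * c\<^sup>2) ([:1, - 1 / L1:] * [:1, - 1 / mu2:]) - 1)"
proof -
  have "poly (scaled_residual c L1 mu2 (2 * n)) x = poly (pcompose (cheb n)
     (Polynomial.smult (2 * c\<^sup>2) ([:1, - 1 / L1:] * [:1, - 1 / mu2:]) - 1)) x" for x
    unfolding poly_scaled_residual_even poly_pcompose
    by (rule arg_cong[of _ _ "poly (cheb n)"]) (simp add: algebra_simps diff_divide_distrib)
  then show ?thesis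
    using poly_eq_poly_eq_iff by blast
qed

text \<open>At 0 both linear factors are 1 and the recurrence collapses to that of T_t at
  \<open>c\<close>. For even index this also identifies the normalizer T_n(sigma2(0)) with
  T_{2n}(c).\<close>

lemma poly_scaled_residual_0: "poly (scaled_residual c L1 mu2 t) 0 = poly (cheb t) c"
  by (induction t rule: cheb.induct) auto

text \<open>The substitution omega_t = 2c T_t(c) / T_{t+1}(c) linearizes the fractional recurrence
  of \<open>omega\<close>; the initial value 2 is its case t = 0.\<close>

lemma omega_cheb:
  assumes "1 \<le> c"
  shows "omega c t * poly (cheb (Suc t)) c = 2 * c * poly (cheb t) c"
proof (induction t)
  case 0
  then show ?case by simp
next
  case (Suc t)
  let ?T = "\<lambda>t. poly (cheb t) c"
  have pos: "?T t > 0" for t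
    using cheb_ge_1[OF assms, of t] by linarith
  have "omega c t = 2 * c * ?T t / ?T (Suc t)"
    using Suc pos[of "Suc t"] by (simp add: field_simps)
  then have "1 - omega c t / (4 * c\<^sup>2) = ?T (Suc (Suc t)) / (2 * c * ?T (Suc t))"
    using pos[of "Suc t"] assms by (simp add: field_simps power2_eq_square)
  then show ?case
    using pos[of "Suc (Suc t)"] by (simp add: inverse_eq_divide del: cheb.simps)
qed

section \<open>Real factorization and interpolation\<close>

lemma prod_linear_factors_dvd:
  fixes p :: "'a :: field poly"
  assumes "finite S" and "\<And>x. x \<in> S \<Longrightarrow> poly p x = 0"
  shows "(\<Prod>x\<in>S. [:- x, 1:]) dvd p"
  using assms
proof (induction S)
  case empty
  then show ?case by simp
next
  case (insert x S)
  then obtain k where k: "p = (\<Prod>y\<in>S. [:- y, 1:]) * k" by (meson dvdE insertCI)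
  have "poly (\<Prod>y\<in>S. [:- y, 1:]) x \<noteq> 0"
    using insert.hyps by (auto simp: poly_prod)
  then have "poly k x = 0"
    using insert.prems[of x] k by simp
  then have "[:- x, 1:] dvd k"
    by (simp add: poly_eq_0_iff_dvd)
  then show ?case
    unfolding k prod.insert[OF insert.hyps] by (subst mult.commute) (rule mult_dvd_mono[OF dvd_refl])
qed

text \<open>A nonreal root z = a + bi gives the quadratic: the remainder of \<open>k\<close> modulo
  it is at most linear, real and zero at z, so its imaginary part forces it to vanish. Writing the
  quadratic as a square plus a nonzero square suits the positivity argument for symmetric
  matrices.\<close>

lemma real_poly_factor:
  fixes k :: "real poly"
  assumes "degree k \<noteq> 0"
  obtains (linear) x where "poly k x = 0"
  | (quadratic) a b where "b \<noteq> 0" and "[:- a, 1:] * [:- a, 1:] + [:b * b:] dvd k"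
proof -
  let ?C = "map_poly (of_real :: real \<Rightarrow> complex)"
  interpret C: map_poly_inj_idom_hom "of_real :: real \<Rightarrow> complex" ..
  have "\<not> constant (poly (?C k))"
    using assms by (simp add: constant_degree)
  then obtain z where z: "poly (?C k) z = 0"
    using fundamental_theorem_of_algebra by blast
  define a b where "a = Re z" and "b = Im z"
  show thesis
  proof (cases "b = 0")
    case True
    then have "z = of_real a" by (simp add: a_def b_def complex_eq_iff)
    then have "poly k a = 0" using z by simp
    then show thesis by (rule linear)
  next
    case False
    define f where "f = [:- a, 1:] * [:- a, 1:] + [:b * b:]"
    define r where "r = k mod f"
    have f: "f = [:a * a + b * b, - 2 * a, 1:]"
      by (simp add: f_def)
    have "poly (?C f) z = 0"
      by (simp add: f a_def b_def complex_eq_iff algebra_simps)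
    moreover have "?C k = ?C (k div f) * ?C f + ?C r"
      unfolding r_def by (simp only: C.hom_mult[symmetric] C.hom_add[symmetric] div_mult_mod_eq)
    ultimately have rz: "poly (?C r) z = 0"
      using z by simp
    have "f \<noteq> 0" and "degree f = 2"
      by (simp_all add: f)
    then have "r = 0 \<or> degree r < 2"
      using degree_mod_less[of f k] by (simp add: r_def)
    then have "degree r < 2" by auto
    then have "coeff r n = 0" if "n \<ge> 2" for n
      using that by (intro coeff_eq_0) auto
    then have "r = [:coeff r 0, coeff r 1:]"
      by (intro poly_eqI) (auto simp: coeff_pCons split: nat.splits)
    then obtain r0 r1 where r: "r = [:r0, r1:]" by blast
    have "of_real r0 + z * of_real r1 = 0"
      using rz unfolding r by (simp add: of_real_hom.map_poly_pCons_hom)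
    then have "r = 0"
      using False r by (auto simp: complex_eq_iff b_def)
    then have "f dvd k" by (simp add: r_def dvd_eq_mod_eq_0)
    then show thesis
      using False quadratic unfolding f_def by blast
  qed
qed

lemma lagrange_interpolation_exists:
  fixes f :: "'a :: field \<Rightarrow> 'a"
  assumes "finite S"
  shows "\<exists>g. \<forall>x\<in>S. poly g x = f x"
  using assms
proof (induction S)
  case empty
  then show ?case by simp
next
  case (insert x S)
  then obtain g where g: "\<And>y. y \<in> S \<Longrightarrow> poly g y = f y" by blast
  define h where "h = (\<Prod>y\<in>S. [:- y, 1:])"
  have hx: "poly h x \<noteq> 0" and hS: "\<And>y. y \<in> S \<Longrightarrow> poly h y = 0"
    using insert.hyps by (auto simp: h_def poly_prod)
  have "poly (g + Polynomial.smult ((f x - poly g x) / poly h x) h) y = f y"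
    if "y \<in> insert x S" for y
    using that g hx hS by auto
  then show ?case by blast
qed

lemma lagrange_interpolation_formula:
  fixes p :: "'a :: field poly"
  assumes "finite S" and "degree p < card S"
  shows "poly p z = (\<Sum>x\<in>S. poly p x * (\<Prod>y\<in>S - {x}. (z - y) / (x - y)))"
proof -
  define l where "l x = (\<Prod>y\<in>S - {x}. Polynomial.smult (1 / (x - y)) [:- y, 1:])" for x
  define q where "q = (\<Sum>x\<in>S. Polynomial.smult (poly p x) (l x))"
  have poly_l: "poly (l x) z = (\<Prod>y\<in>S - {x}. (z - y) / (x - y))" for x z
    by (auto simp: l_def poly_prod diff_divide_distrib intro!: prod.cong)
  have degree_l: "degree (l x) < card S" if "x \<in> S" for x
  proof -
    have "degree (l x) \<le> sum (degree \<circ> (\<lambda>y. Polynomial.smult (1 / (x - y)) [:- y, 1:])) (S - {x})"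
      unfolding l_def using assms(1) by (intro degree_prod_sum_le) auto
    also have "\<dots> \<le> (\<Sum>y\<in>S - {x}. 1)"
    proof (rule sum_mono)
      fix y
      show "(degree \<circ> (\<lambda>y. Polynomial.smult (1 / (x - y)) [:- y, 1:])) y \<le> 1"
        using degree_smult_le[of "1 / (x - y)" "[:- y, 1:]"] by (simp del: smult_pCons)
    qed
    also have "\<dots> < card S"
      using card_Diff1_less[OF assms(1) that] by simp
    finally show ?thesis .
  qed
  have "degree q < card S"
    unfolding q_def using assms degree_l
    by (intro degree_sum_less) (auto intro: le_less_trans[OF degree_smult_le])
  moreover have "poly p w = poly q w" if w: "w \<in> S" for w
  proof -
    have "poly (l x) w = (if x = w then 1 else 0)" if "x \<in> S" for x
      unfolding poly_l using assms(1) w by (auto intro!: prod_zero prod.neutral)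
    then show ?thesis
      using w assms(1) by (simp add: q_def poly_sum if_distrib[of "\<lambda>x. _ * x"] cong: if_cong)
  qed
  ultimately have "p = q"
    using assms by (intro poly_eqI_degree[of S]) auto
  then have "poly p z = poly q z" by simp
  then show ?thesis
    by (simp add: q_def poly_sum poly_l)
qed

section \<open>The spectral norm bound for symmetric matrices\<close>

lemma scalar_prod_self_ge_0: "0 \<le> v \<bullet> (v :: real vec)"
  by (simp add: scalar_prod_def sum_nonneg)

lemma scalar_prod_self_eq_0:
  assumes "v \<in> carrier_vec d" and "v \<bullet> (v :: real vec) = 0"
  shows "v = 0\<^sub>v d"
proof -
  have "v $ i = 0" if "i < d" for i
    using assms that by (simp add: scalar_prod_def sum_nonneg_eq_0_iff)
  then show ?thesis
    using assms(1) by (intro eq_vecI) auto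
qed

context
  fixes A :: "real mat" and d :: nat
  assumes A: "A \<in> carrier_mat d d"
begin

lemma poly_app_sum_index:
  assumes v: "v \<in> carrier_vec d" and "finite J" and i: "i < d"
  shows "poly_app A (\<Sum>j\<in>J. p j) v $ i = (\<Sum>j\<in>J. poly_app A (p j) v $ i)"
  using assms(2)
proof (induction J)
  case empty
  then show ?case using i poly_app_0[OF A v] by simp
next
  case (insert j J)
  have "dim_vec (poly_app A (sum p J) v) = d"
    using poly_app_carrier[OF A v] by (metis carrier_vecD)
  then show ?case
    using insert i by (simp add: poly_app_add[OF A v] del: dim_mult_mat_vec)
qed

text \<open>The d+1 vectors v, Av, ..., A^d v are linearly dependent in dimension d.\<close>

lemma annihilating_poly_exists:
  assumes v: "v \<in> carrier_vec d"
  shows "\<exists>q. q \<noteq> 0 \<and> poly_app A q v = 0\<^sub>v d"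
proof -
  \<comment> \<open>The Krylov vectors are the columns; the added zero row makes the matrix square
    and singular, so the determinant criterion yields a dependency.\<close>
  define B where
    "B = mat (Suc d) (Suc d) (\<lambda>(i, j). if i < d then poly_app A (monom 1 j) v $ i else 0)"
  have B: "B \<in> carrier_mat (Suc d) (Suc d)"
    by (simp add: B_def)
  have "det B = (\<Sum>j<Suc d. B $$ (d, j) * cofactor B d j)"
    by (rule laplace_expansion_row[OF B]) simp
  also have "\<dots> = 0"
    by (intro sum.neutral) (auto simp: B_def)
  finally obtain w where w: "w \<in> carrier_vec (Suc d)" "w \<noteq> 0\<^sub>v (Suc d)" "B *\<^sub>v w = 0\<^sub>v (Suc d)"
    using det_0_iff_vec_prod_zero[OF B] by blast
  define q where "q = (\<Sum>j<Suc d. Polynomial.smult (w $ j) (monom 1 j))"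
  obtain j where j: "j < Suc d" "w $ j \<noteq> 0"
    using w(1,2) by (metis carrier_vecD eq_vecI index_zero_vec)
  have "coeff q j = w $ j"
    using j(1) by (simp add: q_def coeff_sum if_distrib[of "\<lambda>x. _ * x"] cong: if_cong del: sum.lessThan_Suc)
  then have "q \<noteq> 0" using j(2) by auto
  moreover have "poly_app A q v = 0\<^sub>v d"
  proof (rule eq_vecI)
    fix i assume "i < dim_vec (0\<^sub>v d :: real vec)"
    then have i: "i < d" by simp
    have dim: "dim_vec (poly_app A p v) = d" for p
      using poly_app_carrier[OF A v] by (metis carrier_vecD)
    have "poly_app A q v $ i = (\<Sum>j<Suc d. w $ j * poly_app A (monom 1 j) v $ i)"
      unfolding q_def poly_app_sum_index[OF v finite_lessThan i] poly_app_smult[OF A v]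
      using i dim by (simp del: dim_mult_mat_vec index_mult_mat_vec sum.lessThan_Suc)
    also have "\<dots> = (B *\<^sub>v w) $ i"
      using i w(1) B by (simp add: B_def scalar_prod_def lessThan_atLeast0 mult.commute
        del: sum.lessThan_Suc sum.op_ivl_Suc)
    also have "\<dots> = 0\<^sub>v d $ i"
      using w(3) i by simp
    finally show "poly_app A q v $ i = 0\<^sub>v d $ i" .
  next
    show "dim_vec (poly_app A q v) = dim_vec (0\<^sub>v d :: real vec)"
      using poly_app_carrier[OF A v] by (metis carrier_vecD index_zero_vec(2))
  qed
  ultimately show ?thesis by blast
qed

context
  assumes sym: "transpose_mat A = A"
begin

lemma poly_app_self_scalar_prod:
  assumes "v \<in> carrier_vec d"
  shows "poly_app A p v \<bullet> poly_app A p v = v \<bullet> poly_app A (p * p) v"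
  using assms A by (simp add: poly_app_scalar_prod[OF A sym] poly_app_mult[OF A])

lemma poly_app_square_zero:
  assumes v: "v \<in> carrier_vec d" and "poly_app A (p * p) v = 0\<^sub>v d"
  shows "poly_app A p v = 0\<^sub>v d"
  using assms poly_app_self_scalar_prod[OF v, of p] poly_app_carrier[OF A v]
  by (intro scalar_prod_self_eq_0) auto

text \<open>Pairing the hypothesis with v gives ||p(A)v||^2 + b^2 ||v||^2 = 0, by symmetry of
  \<open>A\<close>.\<close>

lemma poly_app_irreducible_quadratic_zero:
  assumes v: "v \<in> carrier_vec d" and "poly_app A (p * p + [:b * b:]) v = 0\<^sub>v d" and "b \<noteq> 0"
  shows "v = 0\<^sub>v d"
proof -
  note c = poly_app_carrier[OF A v]
  have "0 = v \<bullet> poly_app A (p * p + Polynomial.smult (b * b) 1) v"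
    using assms(2) v by (simp add: one_pCons)
  also have "\<dots> = poly_app A p v \<bullet> poly_app A p v + b * b * (v \<bullet> v)"
    unfolding poly_app_add[OF A v] poly_app_smult[OF A v] poly_app_1[OF A v] poly_app_self_scalar_prod[OF v]
    using v c by (simp add: scalar_prod_add_distrib[where n = d])
  finally have "b * b * (v \<bullet> v) \<le> 0"
    using scalar_prod_self_ge_0[of "poly_app A p v"] by linarith
  then have "v \<bullet> v = 0"
    using scalar_prod_self_ge_0[of v] \<open>b \<noteq> 0\<close>
    by (metis mult_le_0_iff not_real_square_gt_zero order_antisym zero_less_mult_iff linorder_not_le)
  then show ?thesis
    using v by (rule scalar_prod_self_eq_0[rotated])
qed

text \<open>Replaces diagonalization: a minimal annihilating polynomial of \<open>v\<close> has only simple real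
  roots, because for symmetric \<open>A\<close> neither a quadratic factor without real roots nor a repeated
  root can be needed to annihilate a vector.\<close>
lemma annihilated_if_zero_on_eigenvalues:
  assumes v: "v \<in> carrier_vec d"
  obtains S where "finite S" and "\<And>x. x \<in> S \<Longrightarrow> eigenvalue A x"
    and "\<And>g. (\<And>x. x \<in> S \<Longrightarrow> poly g x = 0) \<Longrightarrow> poly_app A g v = 0\<^sub>v d"
proof -
  let ?ann = "\<lambda>q. q \<noteq> 0 \<and> poly_app A q v = 0\<^sub>v d"
  obtain q where q: "?ann q" and min: "\<And>r. ?ann r \<Longrightarrow> degree q \<le> degree r"
    using ex_has_least_nat[of ?ann _ degree] annihilating_poly_exists[OF v] by meson
  \<comment> \<open>Minimality of \<open>q\<close> in usable form: no proper divisor annihilates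
    v.\<close>
  have cofactor: "poly_app A s v \<noteq> 0\<^sub>v d" if "q = f * s" "degree f > 0" for f s
  proof
    assume "poly_app A s v = 0\<^sub>v d"
    moreover have "s \<noteq> 0" "f \<noteq> 0" using that q by auto
    ultimately have "degree q \<le> degree s" using min by blast
    with that \<open>s \<noteq> 0\<close> \<open>f \<noteq> 0\<close> show False
      by (simp add: degree_mult_eq)
  qed
  define S where "S = {x. poly q x = 0}"
  define h where "h = (\<Prod>x\<in>S. [:- x, 1:])"
  have S: "finite S"
    using q by (simp add: S_def poly_roots_finite)
  have eigen: "eigenvalue A x" if "x \<in> S" for x
  proof -
    from that obtain s where s: "q = [:- x, 1:] * s"
      by (auto simp: S_def poly_eq_0_iff_dvd elim: dvdE)
    \<comment> \<open>An eigenvector: nonzero by \<open>cofactor\<close>, and killed by X - x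
      because \<open>q\<close> annihilates v.\<close>
    define u where "u = poly_app A s v"
    have u: "u \<in> carrier_vec d" "u \<noteq> 0\<^sub>v d"
      using cofactor[OF s] poly_app_carrier[OF A v] by (auto simp: u_def)
    have "[:- x, 1:] = [:0, 1:] - Polynomial.smult x 1"
      by (simp add: one_pCons)
    then have "A *\<^sub>v u - x \<cdot>\<^sub>v u = poly_app A [:- x, 1:] u"
      using u(1) by (simp only: poly_app_diff[OF A] poly_app_smult[OF A] poly_app_X[OF A] poly_app_1[OF A])
    also have "\<dots> = 0\<^sub>v d"
      using q v by (simp only: s u_def poly_app_mult[OF A])
    finally have *: "A *\<^sub>v u - x \<cdot>\<^sub>v u = 0\<^sub>v d" .
    have "A *\<^sub>v u = x \<cdot>\<^sub>v u"
    proof (rule eq_vecI)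
      fix i assume "i < dim_vec (x \<cdot>\<^sub>v u)"
      then show "(A *\<^sub>v u) $ i = (x \<cdot>\<^sub>v u) $ i"
        using arg_cong[OF *, of "\<lambda>w. w $ i"] A u(1) by auto
    qed (use A u in auto)
    then show ?thesis
      using u A unfolding eigenvalue_def eigenvector_def by auto
  qed
  have "h dvd q"
    unfolding h_def using S by (intro prod_linear_factors_dvd) (auto simp: S_def)
  then obtain k where k: "q = h * k" by (elim dvdE)
  \<comment> \<open>Any nonconstant part of \<open>k\<close> would make \<open>q\<close> reducible
    as an annihilator: a real root of \<open>k\<close> repeats one already in \<open>h\<close>, and
    a nonreal pair is excluded by positivity.\<close>
  have "degree k = 0"
  proof (rule ccontr)
    assume "degree k \<noteq> 0"
    then show False
    proof (cases rule: real_poly_factor)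
      case (linear x)
      then obtain k' where k': "k = [:- x, 1:] * k'"
        by (auto simp: poly_eq_0_iff_dvd elim: dvdE)
      have "x \<in> S"
        using linear k by (simp add: S_def)
      then obtain h' where h': "h = [:- x, 1:] * h'"
        using S unfolding h_def by (metis prod.remove)
      have qx: "q = ([:- x, 1:] * [:- x, 1:]) * (h' * k')"
        unfolding k k' h' by (simp only: ac_simps)
      have "poly_app A [:- x, 1:] (poly_app A (h' * k') v) = 0\<^sub>v d"
      proof (rule poly_app_square_zero)
        show "poly_app A ([:- x, 1:] * [:- x, 1:]) (poly_app A (h' * k') v) = 0\<^sub>v d"
          using q unfolding qx poly_app_mult[OF A v, of "[:- x, 1:] * [:- x, 1:]"] by blast
      qed (rule poly_app_carrier[OF A v])
      then have "poly_app A ([:- x, 1:] * (h' * k')) v = 0\<^sub>v d"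
        by (simp only: poly_app_mult[OF A v, of "[:- x, 1:]"])
      moreover have "q = [:- x, 1:] * ([:- x, 1:] * (h' * k'))"
        unfolding qx by (simp only: ac_simps)
      ultimately show False
        using cofactor[of "[:- x, 1:]"] by simp
    next
      case (quadratic a b)
      define f where "f = [:- a, 1:] * [:- a, 1:] + [:b * b:]"
      from quadratic obtain k' where k': "k = f * k'"
        unfolding f_def by (elim dvdE)
      have qf: "q = f * (h * k')"
        unfolding k k' by (simp only: ac_simps)
      have "degree f > 0"
        by (simp add: f_def)
      have "poly_app A (h * k') v = 0\<^sub>v d"
      proof (rule poly_app_irreducible_quadratic_zero)
        show "poly_app A ([:- a, 1:] * [:- a, 1:] + [:b * b:]) (poly_app A (h * k') v) = 0\<^sub>v d"
          using q unfolding qf poly_app_mult[OF A v, of f] unfolding f_def by blast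
      qed (use poly_app_carrier[OF A v] quadratic in auto)
      then show False
        using cofactor[OF qf \<open>degree f > 0\<close>] by blast
    qed
  qed
  then obtain c where c: "k = [:c:]" by (elim degree_eq_zeroE)
  have "c \<noteq> 0" using c k q by auto
  then have "q dvd h"
    unfolding k c by (simp add: dvd_smult_iff smult_dvd_iff)
  have "poly_app A g v = 0\<^sub>v d" if "\<And>x. x \<in> S \<Longrightarrow> poly g x = 0" for g
  proof (rule poly_app_dvd_zero[OF A v])
    show "poly_app A q v = 0\<^sub>v d" using q by blast
    have "h dvd g" unfolding h_def by (rule prod_linear_factors_dvd[OF S that])
    with \<open>q dvd h\<close> show "q dvd g" by (rule dvd_trans)
  qed
  with S eigen show thesis by (rule that)
qed

text \<open>On v the operator M^2 - p(A)^2 acts as g(A)^2 for a real polynomial g, so the gap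
  between the two sides is ||g(A)v||^2.\<close>

lemma poly_app_norm_bound:
  assumes v: "v \<in> carrier_vec d" and bound: "\<And>x. eigenvalue A x \<Longrightarrow> \<bar>poly p x\<bar> \<le> M"
  shows "poly_app A p v \<bullet> poly_app A p v \<le> M\<^sup>2 * (v \<bullet> v)"
proof -
  obtain S where S: "finite S" "\<And>x. x \<in> S \<Longrightarrow> eigenvalue A x"
    and zero: "\<And>g. (\<And>x. x \<in> S \<Longrightarrow> poly g x = 0) \<Longrightarrow> poly_app A g v = 0\<^sub>v d"
    using annihilated_if_zero_on_eigenvalues[OF v] by blast
  \<comment> \<open>On the eigenvalues in \<open>S\<close>, \<open>M\<^sup>2 - p\<^sup>2\<close> is nonnegative, hence agrees with a square \<open>g\<^sup>2\<close>.\<close>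
  obtain g where g: "\<And>x. x \<in> S \<Longrightarrow> poly g x = sqrt (M\<^sup>2 - (poly p x)\<^sup>2)"
    using lagrange_interpolation_exists[OF S(1), of "\<lambda>x. sqrt (M\<^sup>2 - (poly p x)\<^sup>2)"] by blast
  let ?r = "Polynomial.smult (M\<^sup>2) 1 - p * p - g * g"
  have "poly ?r x = 0" if "x \<in> S" for x
  proof -
    have "(poly p x)\<^sup>2 \<le> M\<^sup>2"
      using bound[OF S(2)[OF that]] by (simp add: abs_le_square_iff[symmetric])
    then have "poly g x * poly g x = M\<^sup>2 - (poly p x)\<^sup>2"
      unfolding g[OF that] by simp
    then show ?thesis
      by (simp add: power2_eq_square)
  qed
  then have "poly_app A ?r v = 0\<^sub>v d" by (rule zero)
  then have "0 = v \<bullet> poly_app A ?r v" using v by simp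
  also have "\<dots> = M\<^sup>2 * (v \<bullet> v) - poly_app A p v \<bullet> poly_app A p v - poly_app A g v \<bullet> poly_app A g v"
    unfolding poly_app_diff[OF A v] poly_app_smult[OF A v] poly_app_1[OF A v] poly_app_self_scalar_prod[OF v]
    using v poly_app_carrier[OF A v] by (simp add: scalar_prod_minus_distrib[where n = d])
  finally show ?thesis
    using scalar_prod_self_ge_0[of "poly_app A g v"] by linarith
qed

end

end

section \<open>Residual polynomials\<close>

lemma poly_app_linear:
  assumes "A \<in> carrier_mat d d" and "v \<in> carrier_vec d"
  shows "poly_app A [:1, a:] v = v + a \<cdot>\<^sub>v (A *\<^sub>v v)"
proof -
  have "[:1, a:] = 1 + Polynomial.smult a [:0, 1:]"
    by (simp add: one_pCons)
  then show ?thesis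
    using assms by (simp only: poly_app_add poly_app_smult poly_app_X poly_app_1)
qed

text \<open>Multiplying by T_t(c) keeps the recurrence free of quotients. Membership in the carrier
  is proved in the same induction, since the vector identities depend on it.\<close>

lemma cheb_method_residual:
  assumes H: "H \<in> carrier_mat d d" and xs: "xs \<in> carrier_vec d" and x0: "x0 \<in> carrier_vec d"
    and c: "c = c_p mu1 L1 mu2 L2" "1 \<le> c"
  shows "cheb_method mu1 L1 mu2 L2 H xs x0 t \<in> carrier_vec d \<and>
    poly_app H (scaled_residual c L1 mu2 t) (x0 - xs) =
      poly (cheb t) c \<cdot>\<^sub>v (cheb_method mu1 L1 mu2 L2 H xs x0 t - xs)"
proof (induction t rule: cheb.induct)
  case 1
  then show ?case
    using x0 xs by (simp add: poly_app_1[OF H])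
next
  case 2
  have "x0 - xs \<in> carrier_vec d" using x0 xs by simp
  then show ?case
    using x0 xs H by (auto simp: poly_app_smult[OF H] poly_app_linear[OF H] grad_def algebra_simps
      simp del: smult_pCons intro!: eq_vecI)
next
  case (3 t)
  let ?X = "cheb_method mu1 L1 mu2 L2 H xs x0" and ?T = "\<lambda>t. poly (cheb t) c"
  let ?E = "\<lambda>t. poly_app H (scaled_residual c L1 mu2 t) (x0 - xs)"
  let ?w = "omega c (Suc t)"
  \<comment> \<open>Iterate \<open>Suc (Suc t)\<close> is produced by the step of index
    \<open>Suc t\<close>, whose parity is opposite to that of \<open>t\<close>.\<close>
  define l where "l = (if even t then mu2 else L1)"
  define g where "g = H *\<^sub>v (?X (Suc t) - xs)"
  have v: "x0 - xs \<in> carrier_vec d" using x0 xs by simp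
  have X: "?X (Suc t) \<in> carrier_vec d" "?X t \<in> carrier_vec d"
    and E: "?E (Suc t) = ?T (Suc t) \<cdot>\<^sub>v (?X (Suc t) - xs)" "?E t = ?T t \<cdot>\<^sub>v (?X t - xs)"
    using 3 by auto
  have g: "g \<in> carrier_vec d" using H X xs by (simp add: g_def)
  have step: "step mu1 L1 mu2 L2 (Suc t) = ?w / l"
    using c by (simp add: step_def l_def)
  have X2: "?X (Suc (Suc t)) = ?X (Suc t) - (?w / l) \<cdot>\<^sub>v g + (?w - 1) \<cdot>\<^sub>v (?X (Suc t) - ?X t)"
    using c by (simp only: cheb_method.simps step g_def grad_def)
  have "?E (Suc (Suc t)) = (2 * c) \<cdot>\<^sub>v (?E (Suc t) + (- 1 / l) \<cdot>\<^sub>v (H *\<^sub>v ?E (Suc t))) - ?E t"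
    unfolding scaled_residual.simps l_def[symmetric]
      poly_app_diff[OF H v] poly_app_smult[OF H v] poly_app_mult[OF H v]
    by (simp only: poly_app_linear[OF H poly_app_carrier[OF H v]])
  also have "\<dots> = (2 * c) \<cdot>\<^sub>v (?T (Suc t) \<cdot>\<^sub>v (?X (Suc t) - xs) + (- 1 / l) \<cdot>\<^sub>v (?T (Suc t) \<cdot>\<^sub>v g))
      - ?T t \<cdot>\<^sub>v (?X t - xs)"
    unfolding E g_def using mult_mat_vec[OF H] X xs by (metis minus_carrier_vec)
  also have "\<dots> = ?T (Suc (Suc t)) \<cdot>\<^sub>v (?X (Suc (Suc t)) - xs)"
  proof (rule eq_vecI)
    fix i assume "i < dim_vec (?T (Suc (Suc t)) \<cdot>\<^sub>v (?X (Suc (Suc t)) - xs))"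
    then have i: "i < d" using xs by simp
    \<comment> \<open>Both coefficients of the method in Chebyshev values: the momentum
      \<open>?w - 1\<close> is T_t/T_{t+2} and \<open>?w\<close> is 2c T_{t+1}/T_{t+2}, all at
      \<open>c\<close>.\<close>
    have T0: "?T t = (?w - 1) * ?T (Suc (Suc t))"
      using omega_cheb[OF c(2), of "Suc t"] by (simp add: algebra_simps)
    have T1: "?T (Suc t) * (2 * c) = ?w * ?T (Suc (Suc t))"
      using omega_cheb[OF c(2), of "Suc t"] by (simp only: mult.commute)
    have arith: "2 * c * (T1 * (x1 - y) + - 1 / l * (T1 * h)) - T0 * (x - y) =
        T2 * (x1 - w / l * h + (w - 1) * (x1 - x) - y)"
      if "T0 = (w - 1) * T2" "T1 * (2 * c) = w * T2" for T0 T1 T2 w x x1 y h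
    proof -
      have "2 * c * (T1 * (x1 - y) + - 1 / l * (T1 * h)) - T0 * (x - y) =
          (T1 * (2 * c)) * (x1 - y) - (T1 * (2 * c)) / l * h - T0 * (x - y)"
        by (simp add: algebra_simps)
      then show ?thesis
        unfolding that by (simp add: algebra_simps)
    qed
    show "((2 * c) \<cdot>\<^sub>v (?T (Suc t) \<cdot>\<^sub>v (?X (Suc t) - xs) + (- 1 / l) \<cdot>\<^sub>v (?T (Suc t) \<cdot>\<^sub>v g))
      - ?T t \<cdot>\<^sub>v (?X t - xs)) $ i = (?T (Suc (Suc t)) \<cdot>\<^sub>v (?X (Suc (Suc t)) - xs)) $ i"
      using arith[OF T0 T1] i X xs g unfolding X2 by (simp del: cheb.simps)
  qed (use xs in simp)
  finally have "?E (Suc (Suc t)) = ?T (Suc (Suc t)) \<cdot>\<^sub>v (?X (Suc (Suc t)) - xs)" .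
  moreover have "?X (Suc (Suc t)) \<in> carrier_vec d"
    unfolding X2 using X g by simp
  ultimately show ?case by blast
qed

lemma cheb_method_even:
  assumes H: "H \<in> carrier_mat d d" and xs: "xs \<in> carrier_vec d" and x0: "x0 \<in> carrier_vec d"
    and "1 \<le> c_p mu1 L1 mu2 L2"
  shows "cheb_method mu1 L1 mu2 L2 H xs x0 (2 * n) - xs = poly_app H (Pn mu1 L1 mu2 L2 n) (x0 - xs)"
proof -
  define c where "c = c_p mu1 L1 mu2 L2"
  let ?X = "cheb_method mu1 L1 mu2 L2 H xs x0 (2 * n)" and ?T = "poly (cheb (2 * n)) c"
  let ?S = "scaled_residual c L1 mu2 (2 * n)"
  have v: "x0 - xs \<in> carrier_vec d" using x0 xs by simp
  have S: "?S = pcompose (cheb n) (sigma2 mu1 L1 mu2 L2)"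
    unfolding scaled_residual_even sigma2_def c_def ..
  have "?T \<ge> 1"
    using assms(4) by (simp add: cheb_ge_1 c_def)
  have "poly_app H (Pn mu1 L1 mu2 L2 n) (x0 - xs) = (1 / ?T) \<cdot>\<^sub>v poly_app H ?S (x0 - xs)"
    unfolding Pn_def S[symmetric] poly_scaled_residual_0 by (rule poly_app_smult[OF H v])
  also have "poly_app H ?S (x0 - xs) = ?T \<cdot>\<^sub>v (?X - xs)"
    using cheb_method_residual[OF H xs x0 c_def] assms(4) by (simp add: c_def)
  also have "(1 / ?T) \<cdot>\<^sub>v \<dots> = ?X - xs"
    using \<open>?T \<ge> 1\<close> by (simp add: smult_smult_assoc)
  finally show ?thesis ..
qed

lemma krylov_residual_poly:
  assumes M: "krylov_method Lambda M" and cls: "in_class Lambda d H xs"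
    and x0: "x0 \<in> carrier_vec d" and "1 \<le> d"
  shows "\<exists>P. degree P \<le> t \<and> poly P 0 = 1 \<and> M H xs fs x0 t - xs = poly_app H P (x0 - xs)"
proof (induction t rule: less_induct)
  case (less t)
  have H: "H \<in> carrier_mat d d" and xs: "xs \<in> carrier_vec d"
    using cls by (auto simp: in_class_def)
  have v: "x0 - xs \<in> carrier_vec d" using x0 xs by simp
  have M0: "M H xs fs x0 0 = x0"
    and MS: "\<And>t. \<exists>a. M H xs fs x0 (Suc t) =
      x0 + finsum_vec TYPE(real) d (\<lambda>s. a s \<cdot>\<^sub>v grad H xs (M H xs fs x0 s)) {..t}"
    using M cls x0 \<open>1 \<le> d\<close> unfolding krylov_method_def by blast+
  show ?case
  proof (cases t)
    case 0
    then show ?thesis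
      using M0 poly_app_1[OF H v] by (intro exI[of _ 1]) simp
  next
    case (Suc m)
    have "\<exists>P. degree P \<le> s \<and> poly P 0 = 1 \<and> M H xs fs x0 s - xs = poly_app H P (x0 - xs)"
      if "s \<in> {..m}" for s
      using less that Suc by simp
    then obtain P where P: "\<And>s. s \<in> {..m} \<Longrightarrow> degree (P s) \<le> s \<and> poly (P s) 0 = 1 \<and>
        M H xs fs x0 s - xs = poly_app H (P s) (x0 - xs)"
      by metis
    obtain a where a: "M H xs fs x0 (Suc m) =
        x0 + finsum_vec TYPE(real) d (\<lambda>s. a s \<cdot>\<^sub>v grad H xs (M H xs fs x0 s)) {..m}"
      using MS by blast
    define r where "r s = Polynomial.smult (a s) ([:0, 1:] * P s)" for s
    define Q where "Q = 1 + (\<Sum>s\<le>m. r s)"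
    have app_r: "a s \<cdot>\<^sub>v grad H xs (M H xs fs x0 s) = poly_app H (r s) (x0 - xs)" if "s \<in> {..m}" for s
      using P[OF that] unfolding r_def grad_def
      by (simp only: poly_app_smult[OF H v] poly_app_mult[OF H v] poly_app_X[OF H poly_app_carrier[OF H v]])
    have carr: "(\<lambda>s. a s \<cdot>\<^sub>v grad H xs (M H xs fs x0 s)) \<in> {..m} \<rightarrow> carrier_vec d"
      using app_r poly_app_carrier[OF H v] by auto
    have "degree (r s) \<le> Suc m" if "s \<le> m" for s
    proof -
      have "degree (r s) \<le> degree ([:0, 1:] * P s)"
        unfolding r_def by (rule degree_smult_le)
      also have "\<dots> \<le> 1 + degree (P s)"
        using degree_mult_le[of "[:0, 1:]" "P s"] by simp
      also have "\<dots> \<le> Suc m"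
        using P[of s] that by simp
      finally show ?thesis .
    qed
    then have "degree Q \<le> Suc m"
      unfolding Q_def by (intro degree_add_le degree_sum_le) auto
    moreover have "poly Q 0 = 1"
      by (simp add: Q_def r_def poly_sum)
    moreover have "M H xs fs x0 (Suc m) - xs = poly_app H Q (x0 - xs)"
    proof (rule eq_vecI)
      have Qc: "poly_app H Q (x0 - xs) \<in> carrier_vec d"
        by (rule poly_app_carrier[OF H v])
      then show "dim_vec (M H xs fs x0 (Suc m) - xs) = dim_vec (poly_app H Q (x0 - xs))"
        using xs by (metis carrier_vecD index_minus_vec(2))
      fix i assume "i < dim_vec (poly_app H Q (x0 - xs))"
      then have i: "i < d" using Qc by (metis carrier_vecD)
      have "(M H xs fs x0 (Suc m) - xs) $ i =
          (x0 - xs) $ i + (\<Sum>s\<le>m. (a s \<cdot>\<^sub>v grad H xs (M H xs fs x0 s)) $ i)"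
        using i xs x0 finsum_vec_closed[OF carr] index_finsum_vec[OF _ i carr]
        unfolding a by simp
      also have "(\<Sum>s\<le>m. (a s \<cdot>\<^sub>v grad H xs (M H xs fs x0 s)) $ i) =
          poly_app H (\<Sum>s\<le>m. r s) (x0 - xs) $ i"
        unfolding poly_app_sum_index[OF H v finite_atMost i] using app_r by (intro sum.cong) auto
      also have "(x0 - xs) $ i + \<dots> = poly_app H Q (x0 - xs) $ i"
        unfolding Q_def poly_app_add[OF H v] poly_app_1[OF H v]
        using i poly_app_carrier[OF H v] by (metis carrier_vecD index_add_vec(1))
      finally show "(M H xs fs x0 (Suc m) - xs) $ i = poly_app H Q (x0 - xs) $ i" .
    qed
    ultimately show ?thesis
      unfolding Suc by blast
  qed
qed

section \<open>Worst-case rates\<close>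

text \<open>The weights are |l(x)|, with l(x) the Lagrange basis values at 0. As all nodes are
  positive, the factor -y/(x - y) is negative exactly for y < x, so l has sign (-1)^k at node k, the
  sign of q there. Hence sum |l| = sum q l = q(0).\<close>

lemma dual_certificate:
  fixes node :: "nat \<Rightarrow> real" and q :: "real poly"
  assumes mono: "\<And>j k. j < k \<Longrightarrow> k \<le> N \<Longrightarrow> node j < node k" and pos: "0 < node 0"
    and alt: "\<And>k. k \<le> N \<Longrightarrow> poly q (node k) = (- 1) ^ k" and "degree q \<le> N"
  obtains w where "\<And>x. 0 \<le> w x" and "(\<Sum>x\<in>node ` {..N}. w x) = poly q 0"
    and "\<And>P. degree P \<le> N \<Longrightarrow> poly P 0 = 1 \<Longrightarrow> 1 \<le> (\<Sum>x\<in>node ` {..N}. w x * \<bar>poly P x\<bar>)"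
proof -
  let ?S = "node ` {..N}"
  define l where "l x = (\<Prod>y\<in>?S - {x}. (0 - y) / (x - y))" for x
  have inj: "inj_on node {..N}"
  proof (rule inj_onI)
    fix j k assume "j \<in> {..N}" "k \<in> {..N}" "node j = node k"
    then show "j = k"
      using mono[of j k] mono[of k j] by (cases j k rule: linorder_cases) auto
  qed
  have card: "card ?S = Suc N"
    by (simp add: card_image[OF inj])
  have pos: "0 < node k" if "k \<le> N" for k
    using pos mono[of 0 k] that by (cases "k = 0") auto
  have interp: "poly P 0 = (\<Sum>x\<in>?S. poly P x * l x)" if "degree P \<le> N" for P
    unfolding l_def by (rule lagrange_interpolation_formula) (use card that in auto)
  have sign: "poly q x * l x = \<bar>l x\<bar>" if "x \<in> ?S" for x
  proof -
    from that obtain k where k: "k \<le> N" "x = node k" by auto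
    let ?f = "\<lambda>j. node j / (node k - node j)"
    have split: "{..N} - {k} = {..<k} \<union> {k<..N}"
      using k(1) by auto
    have "?S - {x} = node ` ({..N} - {k})"
      using inj k by (simp add: inj_on_image_set_diff[where C = "{..N}"])
    then have "l x = (\<Prod>j\<in>{..N} - {k}. - ?f j)"
      unfolding l_def k(2) using inj_on_subset[OF inj, of "{..N} - {k}"]
      by (simp add: prod.reindex)
    also have "\<dots> = (\<Prod>j<k. - ?f j) * (\<Prod>j\<in>{k<..N}. - ?f j)"
      unfolding split by (rule prod.union_disjoint) auto
    also have "(\<Prod>j<k. - ?f j) = (- 1) ^ k * (\<Prod>j<k. ?f j)"
      by (simp add: prod_uminus)
    finally have "l x = (- 1) ^ k * ((\<Prod>j<k. ?f j) * (\<Prod>j\<in>{k<..N}. - ?f j))"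
      by simp
    moreover have "0 \<le> (\<Prod>j<k. ?f j)"
      using k(1) mono pos by (intro prod_nonneg ballI divide_nonneg_nonneg) (auto intro: less_imp_le)
    moreover have "0 \<le> (\<Prod>j\<in>{k<..N}. - ?f j)"
    proof (intro prod_nonneg ballI)
      fix j assume "j \<in> {k<..N}"
      then have "node k < node j" "0 < node j"
        using mono pos by auto
      then show "0 \<le> - ?f j"
        by (simp add: divide_nonneg_neg)
    qed
    ultimately show ?thesis
      using alt[OF k(1)] k(2) by (simp add: abs_mult)
  qed
  show thesis
  proof (rule that[of "\<lambda>x. \<bar>l x\<bar>"])
    show "(\<Sum>x\<in>?S. \<bar>l x\<bar>) = poly q 0"
      unfolding interp[OF \<open>degree q \<le> N\<close>] using sign by (intro sum.cong) auto
  next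
    fix P :: "real poly" assume P: "degree P \<le> N" "poly P 0 = 1"
    have "1 = (\<Sum>x\<in>?S. poly P x * l x)"
      using interp[OF P(1)] P(2) by simp
    also have "\<dots> \<le> (\<Sum>x\<in>?S. \<bar>l x\<bar> * \<bar>poly P x\<bar>)"
      by (intro sum_mono) (metis abs_ge_self abs_mult mult.commute)
    finally show "1 \<le> (\<Sum>x\<in>?S. \<bar>l x\<bar> * \<bar>poly P x\<bar>)" .
  qed simp
qed

text \<open>Cauchy-Schwarz: the certificate controls a weighted sum of |f|, whereas a rate is a
  Euclidean norm.\<close>

lemma weighted_square_ge:
  fixes w f :: "'a \<Rightarrow> real"
  assumes w: "\<And>x. 0 \<le> w x" and "(\<Sum>x\<in>S. w x) = T" and "0 < T" and "1 \<le> (\<Sum>x\<in>S. w x * \<bar>f x\<bar>)"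
  shows "1 / T \<le> (\<Sum>x\<in>S. w x * (f x)\<^sup>2)"
proof -
  \<comment> \<open>\<open>1 / T\<close> is the value of \<open>\<bar>f\<bar>\<close> in the case of equality.\<close>
  have "0 \<le> (\<Sum>x\<in>S. w x * (\<bar>f x\<bar> - 1 / T)\<^sup>2)"
    by (intro sum_nonneg mult_nonneg_nonneg w zero_le_power2)
  also have "\<dots> = (\<Sum>x\<in>S. w x * (f x)\<^sup>2 - 2 / T * (w x * \<bar>f x\<bar>) + 1 / T\<^sup>2 * w x)"
    by (intro sum.cong) (simp_all add: power2_eq_square algebra_simps)
  also have "\<dots> = (\<Sum>x\<in>S. w x * (f x)\<^sup>2) - 2 / T * (\<Sum>x\<in>S. w x * \<bar>f x\<bar>) + 1 / T\<^sup>2 * T"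
    by (simp add: sum.distrib sum_subtractf sum_distrib_left[symmetric] assms(2) del: times_divide_eq_left)
  also have "\<dots> \<le> (\<Sum>x\<in>S. w x * (f x)\<^sup>2) - 2 / T * 1 + 1 / T\<^sup>2 * T"
    using assms(3,4) by (intro add_right_mono diff_left_mono mult_left_mono) auto
  also have "\<dots> = (\<Sum>x\<in>S. w x * (f x)\<^sup>2) - 1 / T"
    using assms(3) by (simp add: power2_eq_square)
  finally show ?thesis by simp
qed

section \<open>Diagonal quadratics as hard instances\<close>

definition diag_of :: "nat \<Rightarrow> (nat \<Rightarrow> real) \<Rightarrow> real mat" where
  "diag_of d b = mat d d (\<lambda>(i, j). if i = j then b i else 0)"

lemma diag_of_carrier [simp]: "diag_of d b \<in> carrier_mat d d"
  by (simp add: diag_of_def)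

lemma diag_of_mult_vec:
  assumes "v \<in> carrier_vec d" and "i < d"
  shows "(diag_of d b *\<^sub>v v) $ i = b i * v $ i"
proof -
  have "(diag_of d b *\<^sub>v v) $ i = (\<Sum>j\<in>{0..<d}. (if i = j then b i else 0) * v $ j)"
    using assms by (simp add: diag_of_def scalar_prod_def)
  also have "\<dots> = b i * v $ i"
    using assms(2) by (simp add: if_distrib[of "\<lambda>x. x * _"] cong: if_cong)
  finally show ?thesis .
qed

lemma diag_of_poly_app:
  assumes v: "v \<in> carrier_vec d" and i: "i < d"
  shows "poly_app (diag_of d b) P v $ i = poly P (b i) * v $ i"
proof (induction P)
  case 0
  then show ?case
    using i poly_app_0[OF diag_of_carrier v] by simp
next
  case (pCons a P)
  note c = poly_app_carrier[OF diag_of_carrier v]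
  have "(diag_of d b *\<^sub>v poly_app (diag_of d b) P v) $ i = b i * (poly P (b i) * v $ i)"
    using diag_of_mult_vec[OF c i] pCons.IH by simp
  moreover have "dim_vec (diag_of d b *\<^sub>v poly_app (diag_of d b) P v) = d"
    by (simp add: diag_of_def)
  ultimately show ?case
    unfolding poly_app_pCons[OF diag_of_carrier v] using i v
    by (simp add: algebra_simps del: index_mult_mat_vec dim_mult_mat_vec)
qed

lemma diag_of_eigenvalue:
  assumes "eigenvalue (diag_of d b) k"
  shows "k \<in> b ` {..<d}"
proof -
  obtain v where v: "v \<in> carrier_vec d" "v \<noteq> 0\<^sub>v d" "diag_of d b *\<^sub>v v = k \<cdot>\<^sub>v v"
    using assms by (auto simp: eigenvalue_def eigenvector_def diag_of_def)
  then obtain i where i: "i < d" "v $ i \<noteq> 0"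
    by (metis carrier_vecD eq_vecI index_zero_vec)
  have "b i * v $ i = k * v $ i"
    using diag_of_mult_vec[OF v(1) i(1), of b] v(1,3) i by simp
  then show ?thesis using i by auto
qed

lemma diag_of_in_class:
  assumes "b ` {..<d} \<subseteq> Lambda"
  shows "in_class Lambda d (diag_of d b) (0\<^sub>v d)"
proof -
  have "transpose_mat (diag_of d b) = diag_of d b"
    by (intro eq_matI) (auto simp: diag_of_def)
  then show ?thesis
    using assms diag_of_eigenvalue by (auto simp: in_class_def)
qed

lemma wc_rate_krylov_ge:
  assumes M: "krylov_method Lambda M" and S: "finite S" "S \<subseteq> Lambda"
    and w: "\<And>x. 0 \<le> w x" "(\<Sum>x\<in>S. w x) = T" and "0 < T"
    and dual: "\<And>P. degree P \<le> t \<Longrightarrow> poly P 0 = 1 \<Longrightarrow> 1 \<le> (\<Sum>x\<in>S. w x * \<bar>poly P x\<bar>)"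
  shows "ereal (1 / T) \<le> wc_rate Lambda M t"
proof -
  define d where "d = card S"
  have "S \<noteq> {}" using w(2) \<open>0 < T\<close> by auto
  then have "1 \<le> d" using S(1) by (simp add: d_def Suc_le_eq card_gt_0_iff)
  obtain b where b: "bij_betw b {..<d} S"
    using ex_bij_betw_nat_finite[OF S(1)] by (auto simp: d_def lessThan_atLeast0)
  define H where "H = diag_of d b"
  define v where "v = vec d (\<lambda>i. sqrt (w (b i)))"
  have H: "H \<in> carrier_mat d d" and v: "v \<in> carrier_vec d"
    by (simp_all add: H_def v_def)
  have cls: "in_class Lambda d H (0\<^sub>v d)"
    unfolding H_def using b S(2) by (intro diag_of_in_class) (auto simp: bij_betw_def)
  have "\<exists>P. degree P \<le> t \<and> poly P 0 = 1 \<and> M H (0\<^sub>v d) 0 v t - 0\<^sub>v d = poly_app H P v"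
    using krylov_residual_poly[OF M cls v \<open>1 \<le> d\<close>, of t 0] v by auto
  then obtain P where P: "degree P \<le> t" "poly P 0 = 1"
    and x: "M H (0\<^sub>v d) 0 v t - 0\<^sub>v d = poly_app H P v" by blast
  have norm: "poly_app H Q v \<bullet> poly_app H Q v = (\<Sum>x\<in>S. w x * (poly Q x)\<^sup>2)" for Q
  proof -
    have "poly_app H Q v \<bullet> poly_app H Q v = (\<Sum>i<d. (poly_app H Q v $ i)\<^sup>2)"
      using poly_app_carrier[OF H v, of Q]
      by (simp add: scalar_prod_def power2_eq_square lessThan_atLeast0 del: dim_mult_mat_vec index_mult_mat_vec)
    also have "\<dots> = (\<Sum>i<d. w (b i) * (poly Q (b i))\<^sup>2)"
    proof (rule sum.cong)
      fix i assume "i \<in> {..<d}"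
      then have "poly_app H Q v $ i = poly Q (b i) * sqrt (w (b i))"
        unfolding H_def using diag_of_poly_app[OF v] by (simp add: v_def)
      then show "(poly_app H Q v $ i)\<^sup>2 = w (b i) * (poly Q (b i))\<^sup>2"
        using w(1) by (simp add: power_mult_distrib)
    qed simp
    also have "\<dots> = (\<Sum>x\<in>S. w x * (poly Q x)\<^sup>2)"
      by (rule sum.reindex_bij_betw[OF b])
    finally show ?thesis .
  qed
  have vv: "v \<bullet> v = T"
    using norm[of 1] w(2) by (simp add: poly_app_1[OF H v])
  then have "v \<noteq> 0\<^sub>v d"
    using \<open>0 < T\<close> by auto
  \<comment> \<open>The left side is 1/T, written so that its root is 1/T times the norm of
    \<open>v\<close>, because ||v||^2 = T.\<close>
  have "(1 / T)\<^sup>2 * T \<le> poly_app H P v \<bullet> poly_app H P v"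
    unfolding norm using weighted_square_ge[of w S T "poly P"] w \<open>0 < T\<close> dual[OF P]
    by (simp add: power2_eq_square)
  then have "sqrt ((1 / T)\<^sup>2 * T) \<le> vnorm (poly_app H P v)"
    unfolding vnorm_def by (rule real_sqrt_le_mono)
  then have "1 / T * vnorm v \<le> vnorm (poly_app H P v)"
    using \<open>0 < T\<close> by (simp add: real_sqrt_mult vnorm_def vv)
  then have "1 / T \<le> vnorm (M H (0\<^sub>v d) 0 v t - 0\<^sub>v d) / vnorm (v - 0\<^sub>v d)"
    using \<open>0 < T\<close> v vv unfolding x by (simp add: pos_le_divide_eq vnorm_def)
  then show ?thesis
    unfolding wc_rate_def using cls v \<open>1 \<le> d\<close> \<open>v \<noteq> 0\<^sub>v d\<close>
    by (intro SUP_upper2[of "(d, H, 0\<^sub>v d, 0, v)"]) auto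
qed

lemma wc_rate_le:
  assumes res: "\<And>d H xs fs x0. 1 \<le> d \<Longrightarrow> in_class Lambda d H xs \<Longrightarrow> x0 \<in> carrier_vec d \<Longrightarrow>
      M H xs fs x0 t - xs = poly_app H P (x0 - xs)"
    and bound: "\<And>x. x \<in> Lambda \<Longrightarrow> \<bar>poly P x\<bar> \<le> B" and "0 \<le> B"
  shows "wc_rate Lambda M t \<le> ereal B"
  unfolding wc_rate_def
proof (rule SUP_least, clarify)
  fix d and H :: "real mat" and xs and fs :: real and x0 :: "real vec"
  assume d: "1 \<le> d" and cls: "in_class Lambda d H xs" and x0: "x0 \<in> carrier_vec d"
  have H: "H \<in> carrier_mat d d" "transpose_mat H = H" and xs: "xs \<in> carrier_vec d"
    and eig: "\<And>k. eigenvalue H k \<Longrightarrow> k \<in> Lambda"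
    using cls by (auto simp: in_class_def)
  have v: "x0 - xs \<in> carrier_vec d" using x0 xs by simp
  have "poly_app H P (x0 - xs) \<bullet> poly_app H P (x0 - xs) \<le> B\<^sup>2 * ((x0 - xs) \<bullet> (x0 - xs))"
    using bound eig by (intro poly_app_norm_bound[OF H v]) blast
  then have "vnorm (poly_app H P (x0 - xs)) \<le> sqrt (B\<^sup>2 * ((x0 - xs) \<bullet> (x0 - xs)))"
    unfolding vnorm_def by (rule real_sqrt_le_mono)
  then have *: "vnorm (M H xs fs x0 t - xs) \<le> B * vnorm (x0 - xs)"
    using \<open>0 \<le> B\<close> unfolding res[OF d cls x0] by (simp add: real_sqrt_mult vnorm_def)
  have "0 \<le> vnorm (x0 - xs)"
    by (simp add: vnorm_def scalar_prod_self_ge_0)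
  then have "vnorm (M H xs fs x0 t - xs) / vnorm (x0 - xs) \<le> B"
    \<comment> \<open>For a zero denominator the quotient is 0 by convention.\<close>
    using * \<open>0 \<le> B\<close> by (cases "vnorm (x0 - xs) = 0") (auto simp: divide_le_eq)
  then show "ereal (vnorm (M H xs fs x0 t - xs) / vnorm (x0 - xs)) \<le> ereal B"
    by simp
qed

section \<open>Two intervals of equal length\<close>

context
  fixes mu1 L1 mu2 L2 :: real
  assumes mu1: "0 < mu1" and mu1_L1: "mu1 < L1" and L1_mu2: "L1 < mu2" and mu2_L2: "mu2 < L2"
    and same_length: "L1 - mu1 = L2 - mu2"
begin

lemma L2_eq: "L2 = L1 + mu2 - mu1"
  using same_length by simp

lemma c_p_eq: "c_p mu1 L1 mu2 L2 = sqrt (L1 * mu2 / ((L1 - mu1) * (mu2 - mu1)))"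
proof -
  \<comment> \<open>This is \<open>L2 - mu1\<close>, by equality of the lengths.\<close>
  define D where "D = L1 + mu2 - 2 * mu1"
  have D: "D > 0" using mu1_L1 L1_mu2 by (simp add: D_def)
  have rho: "rho_p mu1 L1 mu2 L2 = (L1 + mu2) / D" and R: "R_p mu1 L1 mu2 L2 = (mu2 - L1) / D"
    by (simp_all add: rho_p_def R_p_def L2_eq D_def)
  have "((L1 + mu2) / D)\<^sup>2 - ((mu2 - L1) / D)\<^sup>2 = 4 * (L1 * mu2) / D\<^sup>2"
    by (simp add: power_divide diff_divide_distrib[symmetric] power2_eq_square algebra_simps)
  moreover have "1 - ((mu2 - L1) / D)\<^sup>2 = (D\<^sup>2 - (mu2 - L1)\<^sup>2) / D\<^sup>2"
    using D by (simp add: power_divide diff_divide_distrib[symmetric] divide_eq_eq diff_divide_eq_iff field_simps)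
  moreover have "D\<^sup>2 - (mu2 - L1)\<^sup>2 = 4 * ((L1 - mu1) * (mu2 - mu1))"
    by (simp add: D_def power2_eq_square algebra_simps)
  ultimately have "((rho_p mu1 L1 mu2 L2)\<^sup>2 - (R_p mu1 L1 mu2 L2)\<^sup>2) / (1 - (R_p mu1 L1 mu2 L2)\<^sup>2)
      = L1 * mu2 / ((L1 - mu1) * (mu2 - mu1))"
    unfolding rho R using D by simp
  then show ?thesis
    by (simp add: c_p_def)
qed

lemma c_p_square: "(c_p mu1 L1 mu2 L2)\<^sup>2 = L1 * mu2 / ((L1 - mu1) * (mu2 - mu1))"
  using mu1 mu1_L1 L1_mu2 by (simp add: c_p_eq)

lemma c_p_ge_1: "1 \<le> c_p mu1 L1 mu2 L2"
proof -
  have "(L1 - mu1) * (mu2 - mu1) \<le> L1 * mu2"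
    using mu1 mu1_L1 L1_mu2 by (intro mult_mono) auto
  then show ?thesis
    unfolding c_p_eq using mu1_L1 L1_mu2 by simp
qed

text \<open>Shows what \<open>c_p\<close> achieves: the value is -1 at the inner endpoints
  \<open>L1\<close>, \<open>mu2\<close> and 1 at \<open>mu1\<close>.\<close>

lemma poly_sigma2:
  "poly (sigma2 mu1 L1 mu2 L2) x = 2 * ((L1 - x) * (mu2 - x)) / ((L1 - mu1) * (mu2 - mu1)) - 1"
proof -
  have "poly (sigma2 mu1 L1 mu2 L2) x =
      2 * (L1 * mu2 / ((L1 - mu1) * (mu2 - mu1))) * ((1 - x / L1) * (1 - x / mu2)) - 1"
    unfolding sigma2_def c_p_square poly_diff poly_smult poly_mult by simp
  also have "(1 - x / L1) * (1 - x / mu2) = (L1 - x) * (mu2 - x) / (L1 * mu2)"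
    using mu1 mu1_L1 L1_mu2 by (simp add: field_simps)
  finally show ?thesis
    using mu1 mu1_L1 L1_mu2 by simp
qed

lemma poly_sigma2_Lam:
  assumes "x \<in> Lam mu1 L1 mu2 L2"
  shows "- 1 \<le> poly (sigma2 mu1 L1 mu2 L2) x" and "poly (sigma2 mu1 L1 mu2 L2) x \<le> 1"
proof -
  have pos: "(L1 - mu1) * (mu2 - mu1) > 0"
    using mu1_L1 L1_mu2 by simp
  \<comment> \<open>The product is negative only in the open gap between the intervals.\<close>
  have "0 \<le> (L1 - x) * (mu2 - x)"
    using assms L1_mu2 by (auto simp: Lam_def zero_le_mult_iff)
  then show "- 1 \<le> poly (sigma2 mu1 L1 mu2 L2) x"
    unfolding poly_sigma2 using pos by simp
  \<comment> \<open>Equals (L1 - mu1)(mu2 - mu1) - (L1 - x)(mu2 - x), an identity that rests on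
    \<open>mu1 + L2 = L1 + mu2\<close>.\<close>
  have "0 \<le> (x - mu1) * (L2 - x)"
    using assms mu1_L1 L1_mu2 mu2_L2 by (auto simp: Lam_def)
  then have "(L1 - x) * (mu2 - x) \<le> (L1 - mu1) * (mu2 - mu1)"
    unfolding L2_eq by (simp add: algebra_simps)
  then have "(L1 - x) * (mu2 - x) / ((L1 - mu1) * (mu2 - mu1)) \<le> 1"
    using pos by (simp only: divide_le_eq_1_pos)
  then show "poly (sigma2 mu1 L1 mu2 L2) x \<le> 1"
    unfolding poly_sigma2 by (simp only: times_divide_eq_right[symmetric])
qed

section \<open>Alternation nodes of T_n(sigma2)\<close>

text \<open>The preimages of \<open>y\<close> under \<open>sigma2\<close> lie at distance \<open>half_width y\<close> from \<open>(L1 + mu2) / 2\<close>.\<close>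
definition half_width :: "real \<Rightarrow> real" where
  "half_width y = sqrt (((mu2 - L1) / 2)\<^sup>2 + (L1 - mu1) * (mu2 - mu1) * ((1 + y) / 2))"

lemma half_width_strict_mono:
  assumes "y < z"
  shows "half_width y < half_width z"
proof -
  have "(L1 - mu1) * (mu2 - mu1) * ((1 + y) / 2) < (L1 - mu1) * (mu2 - mu1) * ((1 + z) / 2)"
    using assms mu1_L1 L1_mu2 by (intro mult_strict_left_mono) auto
  then show ?thesis
    by (simp add: half_width_def)
qed

lemma half_width_square:
  assumes "- 1 \<le> y"
  shows "(half_width y)\<^sup>2 = ((mu2 - L1) / 2)\<^sup>2 + (L1 - mu1) * (mu2 - mu1) * ((1 + y) / 2)"
  using assms mu1_L1 L1_mu2 by (simp add: half_width_def)

lemma half_width_bounds: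
  assumes "- 1 \<le> y" and "y \<le> 1"
  shows "(mu2 - L1) / 2 \<le> half_width y" and "half_width y \<le> (L2 - mu1) / 2"
proof -
  have "half_width (- 1) = (mu2 - L1) / 2"
    using L1_mu2 by (simp add: half_width_def)
  moreover have "half_width 1 = (L2 - mu1) / 2"
  proof -
    have "((mu2 - L1) / 2)\<^sup>2 + (L1 - mu1) * (mu2 - mu1) = ((L2 - mu1) / 2)\<^sup>2"
      unfolding L2_eq by (simp add: power2_eq_square field_simps)
    then show ?thesis
      using mu1_L1 L1_mu2 mu2_L2 by (simp add: half_width_def)
  qed
  moreover have "half_width (- 1) \<le> half_width y" "half_width y \<le> half_width 1"
    using half_width_strict_mono[of "- 1" y] half_width_strict_mono[of y 1] assms
    by (auto simp: le_less)
  ultimately show "(mu2 - L1) / 2 \<le> half_width y" "half_width y \<le> (L2 - mu1) / 2"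
    by simp_all
qed

text \<open>For n >= 1 and k from 0 to 2n the cosine runs from 1 to -1 and back, and the nodes run
  from \<open>mu1\<close> to \<open>L1\<close> (at k = n) and then through the right interval up to
  \<open>L2\<close>.\<close>

definition node :: "nat \<Rightarrow> nat \<Rightarrow> real" where
  "node n k = (L1 + mu2) / 2 +
     (if k \<le> n then - 1 else 1) * half_width (cos (real k * pi / real n))"

lemma node_in_Lam: "node n k \<in> Lam mu1 L1 mu2 L2"
  using half_width_bounds[of "cos (real k * pi / real n)"] L2_eq
  by (auto simp: node_def Lam_def field_simps)

lemma poly_sigma2_node: "poly (sigma2 mu1 L1 mu2 L2) (node n k) = cos (real k * pi / real n)"
proof -
  let ?y = "cos (real k * pi / real n)" and ?m = "(L1 + mu2) / 2"
  have "(L1 - node n k) * (mu2 - node n k) = (node n k - ?m)\<^sup>2 - ((mu2 - L1) / 2)\<^sup>2"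
    by (simp add: power2_eq_square field_simps)
  also have "(node n k - ?m)\<^sup>2 = (half_width ?y)\<^sup>2"
    by (simp add: node_def)
  finally have "(L1 - node n k) * (mu2 - node n k) = (L1 - mu1) * (mu2 - mu1) * ((1 + ?y) / 2)"
    by (simp add: half_width_square)
  then show ?thesis
    unfolding poly_sigma2 using mu1_L1 L1_mu2 by (simp only:) simp
qed

lemma node_strict_mono:
  assumes "1 \<le> n" and "j < k" and "k \<le> 2 * n"
  shows "node n j < node n k"
proof -
  let ?t = "\<lambda>k. real k * pi / real n"
  have n: "real n > 0" using assms by simp
  have t: "?t j < ?t k"
    using assms n by (simp add: divide_strict_right_mono)
  have le: "?t k \<le> pi" if "k \<le> n" for k
    using that n by (simp add: field_simps)
  consider "k \<le> n" | "j \<le> n" "n < k" | "n < j" by linarith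
  then show ?thesis
  proof cases
    case 1
    then have "cos (?t k) < cos (?t j)"
      using t le by (intro cos_monotone_0_pi) auto
    then show ?thesis
      using 1 assms half_width_strict_mono by (simp add: node_def)
  next
    case 2
    \<comment> \<open>The gap \<open>L1 < mu2\<close> strictly separates the two branches from the
      midpoint.\<close>
    have "0 < half_width (cos (?t k))" "0 < half_width (cos (?t j))"
      using half_width_bounds(1)[of "cos (?t k)"] half_width_bounds(1)[of "cos (?t j)"] L1_mu2
      by auto
    with 2 show ?thesis
      by (simp add: node_def)
  next
    case 3
    \<comment> \<open>Reflection moves the angles from [pi, 2 pi] into [0, pi], where the cosine is
      decreasing.\<close>
    have "cos (2 * pi - ?t j) < cos (2 * pi - ?t k)"
    proof (rule cos_monotone_0_pi)
      have "real k * pi \<le> 2 * real n * pi"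
        using assms(3) by (intro mult_right_mono) auto
      then show "0 \<le> 2 * pi - ?t k"
        using n by (simp add: field_simps)
      have "real n * pi \<le> real j * pi"
        using 3 by (intro mult_right_mono) auto
      then show "2 * pi - ?t j \<le> pi"
        using n by (simp add: field_simps)
    qed (use t in simp)
    then have "cos (?t j) < cos (?t k)"
      by (simp add: cos_diff)
    then show ?thesis
      using 3 assms half_width_strict_mono by (simp add: node_def)
  qed
qed

section \<open>Optimality on the two intervals\<close>

lemma cheb_sigma2_0_pos: "0 < poly (pcompose (cheb n) (sigma2 mu1 L1 mu2 L2)) 0"
proof -
  have "1 \<le> poly (sigma2 mu1 L1 mu2 L2) 0"
    using c_p_ge_1 by (simp add: sigma2_def)
  then show ?thesis
    using cheb_ge_1[of "poly (sigma2 mu1 L1 mu2 L2) 0" n] by (simp add: poly_pcompose)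
qed

lemma abs_Pn_le:
  assumes "x \<in> Lam mu1 L1 mu2 L2"
  shows "\<bar>poly (Pn mu1 L1 mu2 L2 n) x\<bar> \<le> 1 / poly (pcompose (cheb n) (sigma2 mu1 L1 mu2 L2)) 0"
proof -
  have "\<bar>poly (pcompose (cheb n) (sigma2 mu1 L1 mu2 L2)) x\<bar> \<le> 1"
    unfolding poly_pcompose by (intro abs_cheb_le_1 poly_sigma2_Lam assms)
  then show ?thesis
    using cheb_sigma2_0_pos[of n] by (simp add: Pn_def abs_mult divide_right_mono)
qed

lemma Lam_dual_certificate:
  assumes "1 \<le> n"
  obtains S w where "finite S" and "S \<subseteq> Lam mu1 L1 mu2 L2" and "\<And>x. 0 \<le> w x"
    and "(\<Sum>x\<in>S. w x) = poly (pcompose (cheb n) (sigma2 mu1 L1 mu2 L2)) 0"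
    and "\<And>P. degree P \<le> 2 * n \<Longrightarrow> poly P 0 = 1 \<Longrightarrow> 1 \<le> (\<Sum>x\<in>S. w x * \<bar>poly P x\<bar>)"
proof -
  let ?q = "pcompose (cheb n) (sigma2 mu1 L1 mu2 L2)"
  \<comment> \<open>T_n(cos(k pi / n)) = cos(k pi); here n must be nonzero.\<close>
  have alt: "poly ?q (node n k) = (- 1) ^ k" for k
    using assms by (simp add: poly_pcompose poly_sigma2_node cheb_cos)
  have deg: "degree ?q \<le> 2 * n"
  proof -
    have "degree (sigma2 mu1 L1 mu2 L2) \<le> 2"
      unfolding sigma2_def by (intro degree_diff_le) auto
    then have "degree (cheb n) * degree (sigma2 mu1 L1 mu2 L2) \<le> n * 2"
      by (intro mult_mono degree_cheb_le) auto
    then show ?thesis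
      by simp
  qed
  have pos: "0 < node n 0"
    using node_in_Lam[of n 0] mu1 mu1_L1 L1_mu2 by (auto simp: Lam_def)
  show thesis
  proof (rule dual_certificate[of "2 * n" "node n" ?q])
    fix w :: "real \<Rightarrow> real"
    assume "\<And>x. 0 \<le> w x" "(\<Sum>x\<in>node n ` {..2 * n}. w x) = poly ?q 0"
      "\<And>P. degree P \<le> 2 * n \<Longrightarrow> poly P 0 = 1 \<Longrightarrow>
        1 \<le> (\<Sum>x\<in>node n ` {..2 * n}. w x * \<bar>poly P x\<bar>)"
    then show thesis
      using node_in_Lam by (intro that[of "node n ` {..2 * n}" w]) auto
  qed (use alt deg pos node_strict_mono[OF assms] in auto)
qed

text \<open>A real \<open>SUP\<close> bounds its members only when the set is bounded above.\<close>

lemma bdd_above_abs_poly_Lam: "bdd_above ((\<lambda>x. \<bar>poly P x\<bar>) ` Lam mu1 L1 mu2 L2)"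
proof -
  have "\<exists>B. \<forall>x. mu1 \<le> x \<and> x \<le> L2 \<longrightarrow> \<bar>poly P x\<bar> \<le> B"
    using mu1_L1 L1_mu2 mu2_L2 by (intro isCont_bounded) auto
  then obtain B where "\<And>x. mu1 \<le> x \<Longrightarrow> x \<le> L2 \<Longrightarrow> \<bar>poly P x\<bar> \<le> B" by blast
  then show ?thesis
    using mu1_L1 L1_mu2 mu2_L2 by (intro bdd_aboveI[of _ B]) (auto simp: Lam_def)
qed

text \<open>Weak duality: 1 <= sum w |P| <= T sup |P|, while |\<open>Pn\<close>| is at most 1/T on
  the two intervals.\<close>

lemma Pn_minimax:
  assumes "1 \<le> n" and "degree P \<le> 2 * n" and "poly P 0 = 1"
  shows "(SUP x \<in> Lam mu1 L1 mu2 L2. \<bar>poly (Pn mu1 L1 mu2 L2 n) x\<bar>)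
    \<le> (SUP x \<in> Lam mu1 L1 mu2 L2. \<bar>poly P x\<bar>)"
proof -
  let ?T = "poly (pcompose (cheb n) (sigma2 mu1 L1 mu2 L2)) 0"
    and ?B = "SUP x \<in> Lam mu1 L1 mu2 L2. \<bar>poly P x\<bar>"
  obtain S w where S: "S \<subseteq> Lam mu1 L1 mu2 L2" and w: "\<And>x. 0 \<le> w x" "(\<Sum>x\<in>S. w x) = ?T"
    and dual: "1 \<le> (\<Sum>x\<in>S. w x * \<bar>poly P x\<bar>)"
    by (rule Lam_dual_certificate[OF assms(1)]) (use assms(2,3) in blast)
  have "1 \<le> (\<Sum>x\<in>S. w x * \<bar>poly P x\<bar>)" by (rule dual)
  also have "\<dots> \<le> (\<Sum>x\<in>S. w x * ?B)"
    using S w(1) by (intro sum_mono mult_left_mono cSUP_upper bdd_above_abs_poly_Lam) auto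
  also have "\<dots> = ?B * ?T"
    by (simp add: sum_distrib_right[symmetric] w(2))
  finally have "1 / ?T \<le> ?B"
    using cheb_sigma2_0_pos[of n] by (simp add: pos_divide_le_eq)
  moreover have "(SUP x \<in> Lam mu1 L1 mu2 L2. \<bar>poly (Pn mu1 L1 mu2 L2 n) x\<bar>) \<le> 1 / ?T"
    using mu1_L1 by (intro cSUP_least abs_Pn_le) (auto simp: Lam_def)
  ultimately show ?thesis by linarith
qed

end

theorem mainTheorem12:
  fixes mu1 L1 mu2 L2 :: real
  assumes "0 < mu1" and "mu1 < L1" and "L1 < mu2" and "mu2 < L2"
    and "L1 - mu1 = L2 - mu2"
  shows "(\<forall>n d H xs x0. 1 \<le> d \<and> in_class (Lam mu1 L1 mu2 L2) d H xs \<and> x0 \<in> carrier_vec d \<longrightarrow>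
            cheb_method mu1 L1 mu2 L2 H xs x0 (2 * n) - xs
              = mat_poly (Pn mu1 L1 mu2 L2 n) H *\<^sub>v (x0 - xs))
       \<and> (\<forall>n \<ge> 1. \<forall>P :: real poly. degree P \<le> 2 * n \<and> poly P 0 = 1 \<longrightarrow>
            (SUP lam \<in> Lam mu1 L1 mu2 L2. \<bar>poly (Pn mu1 L1 mu2 L2 n) lam\<bar>)
              \<le> (SUP lam \<in> Lam mu1 L1 mu2 L2. \<bar>poly P lam\<bar>))
       \<and> (\<forall>n \<ge> 1. \<forall>M. krylov_method (Lam mu1 L1 mu2 L2) M \<longrightarrow>
            wc_rate (Lam mu1 L1 mu2 L2) (\<lambda>H xs fs x0. cheb_method mu1 L1 mu2 L2 H xs x0) (2 * n)
              \<le> wc_rate (Lam mu1 L1 mu2 L2) M (2 * n))"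
proof (intro conjI allI impI)
  fix n d :: nat and H :: "real mat" and xs x0 :: "real vec"
  assume "1 \<le> d \<and> in_class (Lam mu1 L1 mu2 L2) d H xs \<and> x0 \<in> carrier_vec d"
  then show "cheb_method mu1 L1 mu2 L2 H xs x0 (2 * n) - xs =
      mat_poly (Pn mu1 L1 mu2 L2 n) H *\<^sub>v (x0 - xs)"
    using c_p_ge_1[OF assms] by (intro cheb_method_even) (auto simp: in_class_def)
next
  fix n :: nat and P :: "real poly"
  assume "1 \<le> n" and "degree P \<le> 2 * n \<and> poly P 0 = 1"
  then show "(SUP lam \<in> Lam mu1 L1 mu2 L2. \<bar>poly (Pn mu1 L1 mu2 L2 n) lam\<bar>)
      \<le> (SUP lam \<in> Lam mu1 L1 mu2 L2. \<bar>poly P lam\<bar>)"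
    using Pn_minimax[OF assms] by blast
next
  fix n :: nat and M :: "real mat \<Rightarrow> real vec \<Rightarrow> real \<Rightarrow> real vec \<Rightarrow> nat \<Rightarrow> real vec"
  assume n: "1 \<le> n" and M: "krylov_method (Lam mu1 L1 mu2 L2) M"
  let ?T = "poly (pcompose (cheb n) (sigma2 mu1 L1 mu2 L2)) 0"
  have pos: "0 < ?T"
    by (rule cheb_sigma2_0_pos[OF assms])
  \<comment> \<open>The number \<open>1 / ?T\<close> separates the rates: the spectral bound puts
    this method below it, the certificate puts every span method above it.\<close>
  have "wc_rate (Lam mu1 L1 mu2 L2) (\<lambda>H xs fs x0. cheb_method mu1 L1 mu2 L2 H xs x0) (2 * n)
      \<le> ereal (1 / ?T)"
  proof (rule wc_rate_le)
    fix d and H :: "real mat" and xs x0 :: "real vec"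
    assume "1 \<le> d" "in_class (Lam mu1 L1 mu2 L2) d H xs" "x0 \<in> carrier_vec d"
    then show "cheb_method mu1 L1 mu2 L2 H xs x0 (2 * n) - xs = poly_app H (Pn mu1 L1 mu2 L2 n) (x0 - xs)"
      using c_p_ge_1[OF assms] by (intro cheb_method_even) (auto simp: in_class_def)
  qed (use abs_Pn_le[OF assms] pos in auto)
  also have "ereal (1 / ?T) \<le> wc_rate (Lam mu1 L1 mu2 L2) M (2 * n)"
    by (rule Lam_dual_certificate[OF assms n], rule wc_rate_krylov_ge[OF M _ _ _ _ pos])
  finally show "wc_rate (Lam mu1 L1 mu2 L2) (\<lambda>H xs fs x0. cheb_method mu1 L1 mu2 L2 H xs x0) (2 * n)
      \<le> wc_rate (Lam mu1 L1 mu2 L2) M (2 * n)" .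
qed

end
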